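(* Let $\nu_1,\nu_2$ be Lévy measures on $\mathbb{R}$ such that $\nu_1$ is absolutely continuous with respect to $\nu_2$ and $L_1(\nu_1,\nu_2)<\infty$. Let $(\{x_t\},P^{(f_1,\sigma^2,\nu_1)})$ and $(\{x_t\},P^{(f_2,\sigma^2,\nu_2)})$ be two additive processes with local characteristics $(f_1(\cdot),\sigma^2(\cdot),\nu_1)$ and $(f_2(\cdot),\sigma^2(\cdot),\nu_2)$. Then for any $0<T<\infty$ the following hold. (1) If $\sigma^2>0$ (i.e. $\sigma^2(\cdot)$ is strictly positive), then $$L_1\big(P_T^{(f_1,\sigma^2,\nu_1)},P_T^{(f_2,\sigma^2,\nu_2)}\big)\le 2\sinh\big(T\,L_1(\nu_1,\nu_2)\big)+2\Big[1-2\phi\Big(-\frac{\xi}{2}\Big)\Big],$$ where $\xi\ge 0$ is given by $$\xi^2=\int_0^T\frac{\big(f_2(r)-f_1(r)-(\gamma^{\nu_2}-\gamma^{\nu_1})\big)^2}{\sigma^2(r)}\,dr .$$ (2) If $\sigma^2=0$ (i.e. $\sigma^2(\cdot)\equiv 0$) and $f_1-f_2\equiv\gamma^{\nu_1}-\gamma^{\nu_2}$, then $$L_1\big(P_T^{(f_1,0,\nu_1)},P_T^{(f_2,0,\nu_2)}\big)\le 2\sinh\big(T\,L_1(\nu_1,\nu_2)\big).$$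
   Context: A Lévy measure is a measure $\nu$ on $\mathbb{R}$ with $\nu(\{0\})=0$ and $\int_{\mathbb{R}}(|y|^2\wedge 1)\,\nu(dy)<\infty$. An additive process $\{X_t\}_{t\ge0}$ on $\mathbb{R}$ is a process with $X_0=0$ a.s., independent increments, a.s. right-continuous paths with left limits, and stochastic continuity. It has local characteristics $(f(\cdot),\sigma^2(\cdot),\nu)$, where $f,\sigma^2$ are integrable on every $[0,T]$, $\sigma^2\ge0$, and $\nu$ is a Lévy measure, if for all $u\in\mathbb{R}$, $t\ge0$, $$\mathbb{E}[e^{iuX_t}]=\exp\Big(iu\int_0^t f(r)dr-\frac{u^2}{2}\int_0^t\sigma^2(r)dr-t\int_{\mathbb{R}}\big(1-e^{iuy}+iuy\mathbf{1}_{|y|\le1}\big)\nu(dy)\Big).$$ $D=D([0,\infty),\mathbb{R})$ is the space of right-continuous functions with left limits, $x_t(\omega)=\omega_t$ is the canonical process, $\mathscr{D}$ (resp. $\mathscr{D}_t$) is the $\sigma$-algebra generated by $\{x_s:s\ge0\}$ (resp. $\{x_s:0\le s\le t\}$). $P^{(f,\sigma^2,\nu)}$ is the probability on $(D,\mathscr{D})$ under which $\{x_t\}$ is an additive process with local characteristics $(f,\sigma^2,\nu)$, and $P_T^{(f,\sigma^2,\nu)}$ is its restriction to $\mathscr{D}_T$. For the measures $\nu_1\ll\nu_2$, $L_1(\nu_1,\nu_2)=\int_{\mathbb{R}}\big|\frac{d\nu_1}{d\nu_2}-1\big|d\nu_2$. For probability measures $P,Q$ on $(E,\mathscr{E})$,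 $L_1(P,Q)=2\sup_{A\in\mathscr{E}}|P(A)-Q(A)|$, which equals $\int_E|\frac{dP}{dQ}-1|dQ$ when $P\ll Q$. $\gamma^{\nu_j}$ stands for $\int_{|y|\le1}y\,\nu_j(dy)$; the difference is understood as $\gamma^{\nu_1}-\gamma^{\nu_2}=\int_{|y|\le1}y\,(\nu_1-\nu_2)(dy):=\int_{|y|\le 1}y\big(\frac{d\nu_1}{d\nu_2}(y)-1\big)\nu_2(dy)$, which converges absolutely since $L_1(\nu_1,\nu_2)<\infty$ (and $\gamma^{\nu_2}-\gamma^{\nu_1}$ is its negative). $\phi$ is the cumulative distribution function of the standard normal law, with $\phi(-\infty)=0$. *)

theory Defs
  imports "HOL-Probability.Probability"
begin

section \<open>Levy measures and additive processes\<close>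

definition levy_measure :: "real measure \<Rightarrow> bool" where
  "levy_measure \<nu> \<longleftrightarrow> sets \<nu> = sets borel \<and> emeasure \<nu> {0} = 0 \<and>
     (\<integral>\<^sup>+ y. ennreal (min (\<bar>y\<bar>\<^sup>2) 1) \<partial>\<nu>) < \<infinity>"

text \<open>Paths and processes are indexed by \<^typ>\<open>real\<close>, but only times in \<open>[0,\<infinity>)\<close> are ever
  constrained or observed.\<close>

definition cadlag :: "(real \<Rightarrow> real) \<Rightarrow> bool" where
  "cadlag \<omega> \<longleftrightarrow> (\<forall>t\<ge>0. (\<omega> \<longlongrightarrow> \<omega> t) (at_right t)) \<and> (\<forall>t>0. \<exists>l. (\<omega> \<longlongrightarrow> l) (at_left t))"

definition additive_process :: "'a measure \<Rightarrow> (real \<Rightarrow> 'a \<Rightarrow> real) \<Rightarrow> bool" where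
  "additive_process M X \<longleftrightarrow> prob_space M \<and>
     (\<forall>t\<ge>0. X t \<in> borel_measurable M) \<and>
     (AE \<omega> in M. X 0 \<omega> = 0) \<and>
     (\<forall>(n::nat) (s::nat \<Rightarrow> real). 0 \<le> s 0 \<and> (\<forall>i<n. s i < s (Suc i)) \<longrightarrow>
        prob_space.indep_vars M (\<lambda>_. borel) (\<lambda>i \<omega>. X (s (Suc i)) \<omega> - X (s i) \<omega>) {..<n}) \<and>
     (AE \<omega> in M. cadlag (\<lambda>t. X t \<omega>)) \<and>
     (\<forall>t\<ge>0. \<forall>\<epsilon>>0.
        ((\<lambda>s. measure M {\<omega> \<in> space M. \<bar>X s \<omega> - X t \<omega>\<bar> > \<epsilon>}) \<longlongrightarrow> 0) (at t within {0..}))"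

text \<open>Time integrals are taken against the completed Lebesgue measure, so that \<open>f\<close> and
  \<open>\<sigma>\<^sup>2\<close> (here \<open>s2\<close>, the variance function itself) need not be Borel.\<close>

definition has_local_characteristics ::
  "'a measure \<Rightarrow> (real \<Rightarrow> 'a \<Rightarrow> real) \<Rightarrow> (real \<Rightarrow> real) \<Rightarrow> (real \<Rightarrow> real) \<Rightarrow> real measure \<Rightarrow> bool" where
  "has_local_characteristics M X f s2 \<nu> \<longleftrightarrow>
     (\<forall>T\<ge>0. set_integrable lebesgue {0..T} f \<and> set_integrable lebesgue {0..T} s2) \<and>
     (\<forall>t\<ge>0. s2 t \<ge> 0) \<and>
     levy_measure \<nu> \<and>
     (\<forall>u. \<forall>t\<ge>0. (CLINT \<omega>|M. iexp (u * X t \<omega>)) =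
        exp (\<i> * of_real (u * (LINT r:{0..t}|lebesgue. f r))
             - of_real (u\<^sup>2 / 2 * (LINT r:{0..t}|lebesgue. s2 r))
             - of_real t * (CLINT y|\<nu>. 1 - iexp (u * y) + \<i> * of_real (u * y * indicator {-1..1} y))))"

section \<open>The canonical space\<close>

text \<open>Elements of \<open>D([0,\<infinity>),\<real>)\<close> are made \<^const>\<open>undefined\<close> at negative times, so that they
  correspond one-to-one to functions on \<open>[0,\<infinity>)\<close>.\<close>

definition skorokhod_space :: "(real \<Rightarrow> real) set" where
  "skorokhod_space = {\<omega> \<in> extensional {0..}. cadlag \<omega>}"

definition coord :: "real \<Rightarrow> (real \<Rightarrow> real) \<Rightarrow> real" where
  "coord t \<omega> = \<omega> t"

definition coord_algebra :: "real set \<Rightarrow> (real \<Rightarrow> real) measure" where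
  "coord_algebra I = sigma skorokhod_space
     {coord s -` A \<inter> skorokhod_space | s A. s \<in> I \<and> A \<in> sets borel}"

abbreviation skorokhod_algebra :: "(real \<Rightarrow> real) measure" where
  "skorokhod_algebra \<equiv> coord_algebra {0..}"

abbreviation skorokhod_algebra_upto :: "real \<Rightarrow> (real \<Rightarrow> real) measure" where
  "skorokhod_algebra_upto T \<equiv> coord_algebra {0..T}"

lemma space_coord_algebra [simp]: "space (coord_algebra I) = skorokhod_space"
  by (simp add: coord_algebra_def space_measure_of_conv)

lemma sets_coord_algebra:
  "sets (coord_algebra I) = sigma_sets skorokhod_space
     {coord s -` A \<inter> skorokhod_space | s A. s \<in> I \<and> A \<in> sets borel}"
  unfolding coord_algebra_def by (rule sets_measure_of) auto

lemma subalgebra_coord_algebra: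
  assumes "sets P = sets skorokhod_algebra"
  shows "subalgebra P (skorokhod_algebra_upto T)"
proof -
  have "sets (skorokhod_algebra_upto T) \<subseteq> sets skorokhod_algebra"
    unfolding sets_coord_algebra by (rule sigma_sets_mono') auto
  then show ?thesis
    using sets_eq_imp_space_eq[OF assms] by (simp add: subalgebra_def assms)
qed

text \<open>\<open>P\<close> is a law on path space making the canonical process additive with the given
  local characteristics.\<close>

definition additive_law ::
  "(real \<Rightarrow> real) measure \<Rightarrow> (real \<Rightarrow> real) \<Rightarrow> (real \<Rightarrow> real) \<Rightarrow> real measure \<Rightarrow> bool" where
  "additive_law P f s2 \<nu> \<longleftrightarrow> sets P = sets skorokhod_algebra \<and>
     additive_process P coord \<and> has_local_characteristics P coord f s2 \<nu>"

definition law_upto :: "real \<Rightarrow> (real \<Rightarrow> real) measure \<Rightarrow> (real \<Rightarrow> real) measure" where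
  "law_upto T P = restr_to_subalg P (skorokhod_algebra_upto T)"

section \<open>Distances, drift difference and the normal distribution function\<close>

text \<open>The argument order of the library is reversed: \<^term>\<open>RN_deriv \<nu>2 \<nu>1\<close> is \<open>d\<nu>1/d\<nu>2\<close>.\<close>

definition L1_levy :: "real measure \<Rightarrow> real measure \<Rightarrow> ennreal" where
  "L1_levy \<nu>1 \<nu>2 = (\<integral>\<^sup>+ y. ennreal \<bar>enn2real (RN_deriv \<nu>2 \<nu>1 y) - 1\<bar> \<partial>\<nu>2)"

definition L1_prob :: "'a measure \<Rightarrow> 'a measure \<Rightarrow> real" where
  "L1_prob P Q = 2 * (SUP A\<in>sets P. \<bar>measure P A - measure Q A\<bar>)"

text \<open>The difference \<open>\<gamma>\<^sup>\<nu>\<^sup>1 - \<gamma>\<^sup>\<nu>\<^sup>2\<close>; the two terms need not exist separately.\<close>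

definition gamma_diff :: "real measure \<Rightarrow> real measure \<Rightarrow> real" where
  "gamma_diff \<nu>1 \<nu>2 = (LINT y:{-1..1}|\<nu>2. y * (enn2real (RN_deriv \<nu>2 \<nu>1 y) - 1))"

definition std_normal_cdf :: "ereal \<Rightarrow> real" where
  "std_normal_cdf x = (case x of ereal r \<Rightarrow> cdf std_normal_distribution r | PInfty \<Rightarrow> 1 | MInfty \<Rightarrow> 0)"

text \<open>The integral \<open>\<xi>\<^sup>2\<close> may be infinite.\<close>

definition xi_squared ::
  "real \<Rightarrow> (real \<Rightarrow> real) \<Rightarrow> (real \<Rightarrow> real) \<Rightarrow> (real \<Rightarrow> real) \<Rightarrow> real measure \<Rightarrow> real measure \<Rightarrow> ennreal" where
  "xi_squared T f1 f2 s2 \<nu>1 \<nu>2 =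
     (\<integral>\<^sup>+ r\<in>{0..T}. ennreal ((f2 r - f1 r - (- gamma_diff \<nu>1 \<nu>2))\<^sup>2 / s2 r) \<partial>lebesgue)"

lemma ex1_sqrt_ereal: "\<exists>!\<xi>::ereal. \<xi> \<ge> 0 \<and> \<xi>\<^sup>2 = enn2ereal a"
proof (cases a)
  case (real r)
  show ?thesis
  proof (rule ex1I[of _ "ereal (sqrt r)"])
    show "0 \<le> ereal (sqrt r) \<and> (ereal (sqrt r))\<^sup>2 = enn2ereal a"
      using real by (simp add: enn2ereal_ennreal)
    fix \<xi> :: ereal assume "0 \<le> \<xi> \<and> \<xi>\<^sup>2 = enn2ereal a"
    then show "\<xi> = ereal (sqrt r)"
      using real by (cases \<xi>) (auto simp: enn2ereal_ennreal power2_eq_square)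
  qed
next
  case top
  show ?thesis
  proof (rule ex1I[of _ \<infinity>])
    show "0 \<le> (\<infinity>::ereal) \<and> \<infinity>\<^sup>2 = enn2ereal a"
      using top by (simp add: power2_eq_square top_ereal_def)
    fix \<xi> :: ereal assume "0 \<le> \<xi> \<and> \<xi>\<^sup>2 = enn2ereal a"
    then show "\<xi> = \<infinity>"
      using top by (cases \<xi>) (auto simp: power2_eq_square top_ereal_def)
  qed
qed

end

theory Submission
  imports Defs
begin

text \<open>Write \<open>h = d\<nu>1/d\<nu>2\<close>, \<open>\<alpha> = (h - 1)\<^sup>+ \<nu>2\<close> and \<open>\<beta> = (h - 1)\<^sup>- \<nu>2\<close>, two finite measures whose total masses add
  up to \<open>L1_levy \<nu>1 \<nu>2\<close>. Since \<open>\<nu>1 + \<beta> = \<nu>2 + \<alpha>\<close>, an increment of the first process plus an independent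
  compound Poisson variable with jump measure \<open>\<beta>\<close> has the law of a deterministic shift of the second increment plus
  a compound Poisson variable with jump measure \<open>\<alpha>\<close>. On a partition of \<open>[0,T]\<close> all compound Poisson terms vanish
  outside an event of probability at most \<open>T \<cdot> L1_levy \<nu>1 \<nu>2 \<le> sinh (T \<cdot> L1_levy \<nu>1 \<nu>2)\<close>. The
  shifts are zero in the second case. In the first case they act on the Gaussian factor
  of the increments, and the Neyman-Pearson set of two shifted Gaussian product laws yields
  the term with \<open>\<phi>\<close>; the Cauchy-Schwarz inequality on each interval bounds the
  discrete signal-to-noise ratio by \<open>\<xi>\<^sup>2\<close>. Neither bound depends on the partition, and events depending on
  finitely many times are dense in the path \<open>\<sigma>\<close>-algebra.\<close>

section \<open>Convolutions and compound Poisson laws\<close>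

text \<open>The two laws are accessible through the characteristic functions of their one-time
  marginals and the independence of increments, so laws are compared by identities of characteristic
  functions. This is why jumps are added on both sides instead of being removed down to the common
  part of \<nu>1 and \<nu>2: adding needs only compound Poisson laws, which are explicit because
  \<alpha> and \<beta> are finite, whereas removing would need laws whose existence has to be
  established first. The shift contains \<open>gamma_diff\<close> because \<open>levy_kernel\<close>
  compensates small jumps while the added jumps are uncompensated. The existence question returns
  for the Gaussian factor: what is left of an increment after splitting it off must be shown to be a
  probability law. The increment itself supplies the compactness, since the Gaussian convolved with
  laws of truncated jumps converges weakly to it.\<close>

lemma real_distribution_convolution:
  assumes "real_distribution M" "real_distribution N"
  shows "real_distribution (M \<star> N)"
proof -
  interpret M: real_distribution M by fact
  interpret N: real_distribution N by fact
  interpret P: pair_prob_space M N ..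
  have "prob_space (M \<star> N)"
    unfolding convolution_def by (intro P.prob_space_distr) simp
  then show ?thesis
    by (simp add: real_distribution_def real_distribution_axioms_def)
qed

lemma char_convolution:
  assumes "real_distribution M" "real_distribution N"
  shows "char (M \<star> N) u = char M u * char N u"
proof -
  interpret M: real_distribution M by fact
  interpret N: real_distribution N by fact
  interpret P: pair_prob_space M N ..
  have i: "integrable (M \<Otimes>\<^sub>M N) (\<lambda>(x, y). iexp (u * (x + y)))"
    by (rule P.integrable_const_bound[where B=1]) (auto simp: split_beta)
  have "char (M \<star> N) u = (CLINT z|M \<Otimes>\<^sub>M N. iexp (u * (fst z + snd z)))"
    unfolding char_def convolution_def by (subst integral_distr) (auto simp: split_beta)
  also have "\<dots> = (CLINT x|M. CLINT y|N. iexp (u * (x + y)))"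
    using P.integral_fst'[OF i[unfolded split_beta]] by simp
  also have "\<dots> = (CLINT x|M. iexp (u * x) * char N u)"
    by (simp add: char_def ring_distribs exp_add)
  also have "\<dots> = char M u * char N u"
    by (simp add: char_def)
  finally show ?thesis .
qed

lemma real_distribution_return: "real_distribution (return borel d)"
  by (simp add: real_distribution_def real_distribution_axioms_def prob_space_return)

lemma char_return: "char (return borel d) u = iexp (u * d)"
  unfolding char_def by (subst integral_return) auto

text \<open>Serves compound Poisson laws, which are mixtures of convolution powers. Cosine and sine
  parts are integrated separately, as bounded real integrands.\<close>

lemma char_bind:
  assumes P: "prob_space P" and N: "\<And>x. real_distribution (N x)"
    and [measurable]: "N \<in> P \<rightarrow>\<^sub>M subprob_algebra borel"
  shows "real_distribution (P \<bind> N)" and "char (P \<bind> N) u = (CLINT x|P. char (N x) u)"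
proof -
  interpret P: prob_space P by fact
  interpret N: real_distribution "N x" for x by fact
  have ne: "space P \<noteq> {}" by (rule P.not_empty)
  have sets: "sets (P \<bind> N) = sets borel"
    using ne by (rule sets_bind[rotated]) simp
  have "prob_space (P \<bind> N)"
    by (rule P.prob_space_bind[where S=borel]) (auto intro: N.prob_space_axioms)
  then show rd: "real_distribution (P \<bind> N)"
    using sets by (simp add: real_distribution_def real_distribution_axioms_def)
  interpret B: real_distribution "P \<bind> N" by fact
  have bound: "AE x in P. emeasure (N x) (space (N x)) \<le> ennreal 1"
    using N.emeasure_space_1 by simp
  have split: "char M u = Complex (LINT y|M. cos (u * y)) (LINT y|M. sin (u * y))"
    if "real_distribution M" for M
  proof -
    interpret M: real_distribution M by fact
    have i: "integrable M (\<lambda>x. iexp (u * x))"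
      by (rule M.integrable_const_bound[where B=1]) auto
    have "Re (char M u) = (LINT y|M. cos (u * y))" "Im (char M u) = (LINT y|M. sin (u * y))"
      unfolding char_def integral_Re[OF i, symmetric] integral_Im[OF i, symmetric]
      by (simp_all add: exp_Euler cos_of_real sin_of_real del: of_real_mult)
    then show ?thesis by (simp add: complex_eq_iff)
  qed
  have "(\<lambda>x. LINT y|N x. cos (u * y)) \<in> borel_measurable P"
       "(\<lambda>x. LINT y|N x. sin (u * y)) \<in> borel_measurable P"
    by (rule measurable_compose[OF _ integral_measurable_subprob_algebra]; measurable)+
  note [measurable] = this
  have le: "\<bar>LINT y|N x. cos (u * y)\<bar> \<le> 1" "\<bar>LINT y|N x. sin (u * y)\<bar> \<le> 1" for x
    using N.cmod_char_le_1[of x u] abs_Re_le_cmod[of "char (N x) u"] abs_Im_le_cmod[of "char (N x) u"]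
    unfolding split[OF N] by auto
  have ic: "integrable P (\<lambda>x. LINT y|N x. cos (u * y))" "integrable P (\<lambda>x. LINT y|N x. sin (u * y))"
    using le by (auto intro!: P.integrable_const_bound[where B=1])
  have i: "integrable P (\<lambda>x. char (N x) u)"
  proof (rule P.integrable_const_bound[where B=1])
    show "(\<lambda>x. char (N x) u) \<in> borel_measurable P"
      unfolding split[OF N] Complex_eq by measurable
  qed (auto intro: N.cmod_char_le_1)
  have "char (P \<bind> N) u = Complex (LINT x|P. LINT y|N x. cos (u * y)) (LINT x|P. LINT y|N x. sin (u * y))"
    unfolding split[OF rd]
    by (subst (1 2) integral_bind[where K=borel and B=1 and B'=1]) (auto simp: bound P.finite_measure_axioms N.emeasure_space_1[simplified])
  also have "\<dots> = (CLINT x|P. char (N x) u)"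
    using i by (simp add: complex_eq_iff integral_Re[symmetric] integral_Im[symmetric] del: integral_Re integral_Im)
      (simp add: split[OF N])
  finally show "char (P \<bind> N) u = (CLINT x|P. char (N x) u)" .
qed

text \<open>\<open>K\<close> is the law of a sum of independent jumps with law \<beta> normalised,
  their number being Poisson with mean l = \<tau> times the mass of \<beta>. The sum is nonzero only
  if at least one jump occurs, which has probability 1 - exp (- l) \<le> l.\<close>

lemma compound_poisson_exists:
  assumes fin: "finite_measure \<beta>" and sets_\<beta>[measurable_cong]: "sets \<beta> = sets borel" and \<tau>: "0 \<le> \<tau>"
  obtains K where "real_distribution K"
    "\<And>u. char K u = exp (- (of_real \<tau> * (CLINT y|\<beta>. 1 - iexp (u * y))))"
    "measure K (- {0}) \<le> \<tau> * measure \<beta> (space \<beta>)"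
proof (cases "\<tau> * measure \<beta> (space \<beta>) = 0")
  \<comment> \<open>Without mass or without time there is nothing to normalise, and the unit mass at
    0 serves.\<close>
  case True
  interpret finite_measure \<beta> by fact
  have "of_real \<tau> * (CLINT y|\<beta>. 1 - iexp (u * y)) = 0" for u
  proof (cases "\<tau> = 0")
    case False
    then have "emeasure \<beta> (space \<beta>) = 0" using True by (simp add: emeasure_eq_measure)
    then have "AE y in \<beta>. False" by (intro AE_I[where N="space \<beta>"]) auto
    then have "(CLINT y|\<beta>. 1 - iexp (u * y)) = (CLINT y|\<beta>. 0)"
      by (intro integral_cong_AE) auto
    then show ?thesis by simp
  qed simp
  then show ?thesis
    using True by (intro that[of "return borel 0"])
      (simp_all only: real_distribution_return char_return, simp_all add: measure_return)
next
  case False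
  interpret finite_measure \<beta> by fact
  define b where "b = measure \<beta> (space \<beta>)"
  define l where "l = \<tau> * b"
  have pos: "b > 0" "l > 0"
    using False \<tau> measure_nonneg[of \<beta> "space \<beta>"] by (auto simp: b_def l_def less_le)
  define B where "B = density \<beta> (\<lambda>_. ennreal (1 / b))"
  have "real_distribution B"
    unfolding real_distribution_def real_distribution_axioms_def
  proof
    show "prob_space B"
      using pos by (intro prob_spaceI)
        (simp add: B_def emeasure_density nn_integral_cmult emeasure_eq_measure ennreal_mult[symmetric] flip: b_def)
  qed (simp add: B_def sets_\<beta>)
  have char_B: "char B u = (CLINT y|\<beta>. iexp (u * y)) / b" for u
    unfolding char_def B_def using pos
    by (subst integral_density) (auto simp: scaleR_conv_of_real)
  define N where "N n = ((\<star>) B ^^ n) (return borel 0)" for n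
  have N: "real_distribution (N n)" and char_N: "char (N n) u = char B u ^ n" for n u
    by (induction n) (auto simp: N_def real_distribution_return char_return char_convolution
        \<open>real_distribution B\<close> intro: real_distribution_convolution)
  interpret N: real_distribution "N n" for n by (rule N)
  define P where "P = measure_pmf (poisson_pmf l)"
  interpret P: prob_space P unfolding P_def by (rule prob_space_measure_pmf)
  have Nm: "N \<in> P \<rightarrow>\<^sub>M subprob_algebra borel"
    by (simp add: P_def space_subprob_algebra N.subprob_space_axioms)
  define K where "K = P \<bind> N"
  have K: "real_distribution K"
    unfolding K_def by (rule char_bind(1)[OF P.prob_space_axioms N Nm])
  interpret K: real_distribution K by fact
  have "char K u = exp (- (of_real \<tau> * (CLINT y|\<beta>. 1 - iexp (u * y))))" for u
  proof -
    let ?\<phi> = "char B u"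
    have "norm ?\<phi> \<le> 1"
      using \<open>real_distribution B\<close> by (rule real_distribution.cmod_char_le_1)
    have "(\<lambda>n. exp (- of_real l) * ((of_real l * ?\<phi>) ^ n /\<^sub>R fact n)) sums (exp (- of_real l) * exp (of_real l * ?\<phi>))"
      by (intro sums_mult exp_converges)
    moreover have "(\<lambda>n. exp (- of_real l) * ((of_real l * ?\<phi>) ^ n /\<^sub>R fact n)) = (\<lambda>n. pmf (poisson_pmf l) n *\<^sub>R ?\<phi> ^ n)"
      using pos by (auto simp: scaleR_conv_of_real field_simps power_mult_distrib exp_of_real exp_minus)
    ultimately have s: "(\<lambda>n. pmf (poisson_pmf l) n *\<^sub>R ?\<phi> ^ n) sums (exp (- of_real l) * exp (of_real l * ?\<phi>))"
      by simp
    have i: "integrable P (\<lambda>n. ?\<phi> ^ n)"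
      using \<open>norm ?\<phi> \<le> 1\<close> by (intro P.integrable_const_bound[where B=1]) (auto simp: P_def norm_power power_le_one)
    then have i': "integrable (count_space UNIV) (\<lambda>n. pmf (poisson_pmf l) n *\<^sub>R ?\<phi> ^ n)"
      unfolding P_def measure_pmf_eq_density by (subst (asm) integrable_density) auto
    have "char K u = (CLINT n|P. ?\<phi> ^ n)"
      unfolding K_def by (subst char_bind(2)[OF P.prob_space_axioms N Nm]) (simp add: char_N)
    also have "\<dots> = (CLINT n|count_space UNIV. pmf (poisson_pmf l) n *\<^sub>R ?\<phi> ^ n)"
      unfolding P_def measure_pmf_eq_density by (subst integral_density) auto
    also have "\<dots> = exp (- of_real l) * exp (of_real l * ?\<phi>)"
      using sums_integral_count_space_nat[OF i'] s by (rule sums_unique2)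
    also have "\<dots> = exp (- of_real l + of_real l * ?\<phi>)" by (rule exp_add[symmetric])
    also have "- of_real l + of_real l * ?\<phi> = - (of_real \<tau> * (CLINT y|\<beta>. 1 - iexp (u * y)))"
    proof -
      have "integrable \<beta> (\<lambda>y. iexp (u * y))"
        by (rule integrable_const_bound[where B=1]) auto
      then have "(CLINT y|\<beta>. 1 - iexp (u * y)) = b - (CLINT y|\<beta>. iexp (u * y))"
        by (simp add: b_def scaleR_conv_of_real)
      then show ?thesis
        using pos by (simp add: char_B l_def right_diff_distrib)
    qed
    finally show ?thesis .
  qed
  moreover have "measure K (- {0}) \<le> \<tau> * measure \<beta> (space \<beta>)"
  proof -
    have "emeasure K (- {0}) = (\<integral>\<^sup>+n. emeasure (N n) (- {0}) \<partial>P)"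
      unfolding K_def by (rule emeasure_bind[OF _ Nm]) (auto simp: P.not_empty)
    \<comment> \<open>\<open>N 0\<close> is the unit mass at 0 and contributes nothing; every other
      \<open>N n\<close> is bounded by 1.\<close>
    also have "\<dots> \<le> (\<integral>\<^sup>+n. indicator (- {0}) n \<partial>P)"
    proof (rule nn_integral_mono)
      fix n show "emeasure (N n) (- {0}) \<le> indicator (- {0}) n"
        by (cases n) (auto simp: N_def[of 0] emeasure_return N.measure_le_1)
    qed
    also have "\<dots> = ennreal (1 - exp (- l))"
      using pos measure_pmf.prob_compl[of "{0}" "poisson_pmf l"]
      by (simp add: P_def measure_pmf.emeasure_eq_measure Compl_eq_Diff_UNIV measure_pmf_single)
    finally have "measure K (- {0}) \<le> 1 - exp (- l)"
      using pos by (simp add: K.emeasure_eq_measure ennreal_le_iff)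
    also have "\<dots> \<le> l" using exp_ge_add_one_self[of "- l"] by linarith
    finally show ?thesis by (simp add: l_def b_def)
  qed
  ultimately show ?thesis using K by (intro that)
qed

section \<open>Deconvolution and infinitely divisible laws\<close>

text \<open>\<open>tight\<close> asks for one interval serving every index. Each of the finitely
  many indices before the threshold has an interval of its own, so the maximum of finitely many
  radii serves all.\<close>

lemma tight_if_eventually:
  assumes rd: "\<And>n. real_distribution (\<mu> n)"
    and ev: "\<And>\<epsilon>. \<epsilon> > 0 \<Longrightarrow> \<exists>k. \<forall>\<^sub>F n in sequentially. measure (\<mu> n) {-k<..k} > 1 - \<epsilon>"
  shows "tight \<mu>"
  unfolding tight_def
proof (intro conjI allI impI rd)
  fix \<epsilon> :: real assume \<epsilon>: "\<epsilon> > 0"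
  interpret real_distribution "\<mu> n" for n by (rule rd)
  have mono: "measure (\<mu> n) {-k<..k} \<le> measure (\<mu> n) {-l<..l}" if "k \<le> l" for n k l
    using that by (intro finite_measure_mono) auto
  obtain k N where k: "\<And>n. n \<ge> N \<Longrightarrow> measure (\<mu> n) {-k<..k} > 1 - \<epsilon>"
    using ev[OF \<epsilon>] by (auto simp: eventually_sequentially)
  have "\<exists>m::nat. measure (\<mu> n) {- real m<..real m} > 1 - \<epsilon>" for n
  proof -
    have "(\<lambda>m. measure (\<mu> n) {- real m<..real m}) \<longlonglongrightarrow> measure (\<mu> n) (\<Union>m. {- real m<..real m})"
      by (intro finite_Lim_measure_incseq) (auto simp: incseq_def)
    then have "(\<lambda>m. measure (\<mu> n) {- real m<..real m}) \<longlonglongrightarrow> 1"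
      using prob_space[of n] by (simp add: UN_Ioc_eq_UNIV)
    then have "\<forall>\<^sub>F m in sequentially. measure (\<mu> n) {- real m<..real m} > 1 - \<epsilon>"
      using \<epsilon> by (intro order_tendstoD(1)) auto
    then show ?thesis by (auto simp: eventually_sequentially)
  qed
  then obtain m where m: "\<And>n. measure (\<mu> n) {- real (m n)<..real (m n)} > 1 - \<epsilon>" by metis
  define K where "K = Max (insert (max k 1) ((\<lambda>n. real (m n)) ` {..<N}))"
  have K: "max k 1 \<le> K" "\<And>n. n < N \<Longrightarrow> real (m n) \<le> K"
    unfolding K_def by (rule Max_ge; simp)+
  have "measure (\<mu> n) {-K<..K} > 1 - \<epsilon>" for n
  proof (cases "n < N")
    case True then show ?thesis using K(2) m[of n] mono[of "real (m n)" K n] by fastforce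
  next
    case False then show ?thesis using K(1) k[of n] mono[of k K n] by fastforce
  qed
  then show "\<exists>a b. a < b \<and> (\<forall>n. measure (\<mu> n) {a<..b} > 1 - \<epsilon>)"
    using K(1) by (intro exI[of _ "-K"] exI[of _ K]) auto
qed

text \<open>Weak convergence controls distribution functions only at continuity points of the limit.
  The exceptions are countable, so admissible endpoints exist arbitrarily far out on both
  sides.\<close>

lemma weak_conv_eventually_bounded:
  assumes rd: "\<And>n. real_distribution (\<mu> n)" and rd': "real_distribution M" and w: "weak_conv_m \<mu> M"
    and \<epsilon>: "\<epsilon> > (0::real)"
  shows "\<exists>k. \<forall>\<^sub>F n in sequentially. measure (\<mu> n) {-k<..k} > 1 - \<epsilon>"
proof -
  interpret real_distribution "\<mu> n" for n by (rule rd)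
  interpret M: real_distribution M by (rule rd')
  have cnt: "countable {x. \<not> isCont (cdf M) x}"
    by (intro mono_ctble_discont) (auto simp: mono_def M.cdf_nondecreasing)
  have "\<forall>\<^sub>F x in at_top. cdf M x > 1 - \<epsilon> / 2"
    using \<epsilon> by (intro order_tendstoD(1)[OF M.cdf_lim_at_top_prob]) auto
  then obtain b0 where b0: "\<And>x. x \<ge> b0 \<Longrightarrow> cdf M x > 1 - \<epsilon> / 2" by (auto simp: eventually_at_top_linorder)
  have "\<forall>\<^sub>F x in at_bot. cdf M x < \<epsilon> / 2"
    using \<epsilon> by (intro order_tendstoD(2)[OF M.cdf_lim_at_bot]) auto
  then obtain a0 where a0: "\<And>x. x \<le> a0 \<Longrightarrow> cdf M x < \<epsilon> / 2" by (auto simp: eventually_at_bot_linorder)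
  obtain b where b: "b > b0" "isCont (cdf M) b"
    using open_minus_countable[OF cnt, of "{b0<..}"] by auto
  obtain a where a: "a < a0" "isCont (cdf M) a"
    using open_minus_countable[OF cnt, of "{..<a0}"] by auto
  have "(\<lambda>n. cdf (\<mu> n) b - cdf (\<mu> n) a) \<longlonglongrightarrow> cdf M b - cdf M a"
    using w a b by (intro tendsto_diff) (auto simp: weak_conv_m_def weak_conv_def)
  moreover have "cdf M b - cdf M a > 1 - \<epsilon>" using a0[of a] b0[of b] a b by auto
  ultimately have ev: "\<forall>\<^sub>F n in sequentially. cdf (\<mu> n) b - cdf (\<mu> n) a > 1 - \<epsilon>"
    by (rule order_tendstoD(1))
  define k where "k = max \<bar>a\<bar> \<bar>b\<bar>"
  have "\<forall>\<^sub>F n in sequentially. measure (\<mu> n) {-k<..k} > 1 - \<epsilon>"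
    using ev
  proof eventually_elim
    case (elim n)
    have "cdf (\<mu> n) b - cdf (\<mu> n) a \<le> measure (\<mu> n) {-k<..k}"
    proof (cases "a < b")
      case True
      then show ?thesis
        by (subst cdf_diff_eq) (auto simp: k_def intro!: finite_measure_mono)
    next
      case False
      then have "cdf (\<mu> n) b - cdf (\<mu> n) a \<le> 0" using cdf_nondecreasing[of b a n] by simp
      then show ?thesis using measure_nonneg[of "\<mu> n" "{-k<..k}"] by linarith
    qed
    with elim show ?case by linarith
  qed
  then show ?thesis by blast
qed

text \<open>If \<open>R\<^sub>n \<star> G\<close> converges weakly then the factors \<open>R\<^sub>n\<close> are tight, so a limit point of them
  is a deconvolution of the limit by \<open>G\<close>.\<close>

lemma deconvolution_exists:
  assumes \<mu>: "real_distribution \<mu>" and G: "real_distribution G" and R: "\<And>n. real_distribution (R n)"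
    and lim: "\<And>u. (\<lambda>n. char (R n) u) \<longlonglongrightarrow> \<psi> u"
    and prod: "\<And>u. char \<mu> u = char G u * \<psi> u"
  obtains M where "real_distribution M" "\<And>u. char M u = \<psi> u"
proof -
  interpret R: real_distribution "R n" for n by (rule R)
  interpret G: real_distribution G by (rule G)
  have w: "weak_conv_m (\<lambda>n. R n \<star> G) \<mu>"
  proof (rule levy_continuity)
    show "(\<lambda>n. char (R n \<star> G) u) \<longlonglongrightarrow> char \<mu> u" for u
      unfolding char_convolution[OF R G] prod by (subst mult.commute) (intro tendsto_intros lim)
  qed (intro real_distribution_convolution R G \<mu>)+
  have "tight R"
  proof (rule tight_if_eventually[OF R])
    fix \<epsilon> :: real assume \<epsilon>: "\<epsilon> > 0"
    have "(\<lambda>m. measure G {- real m<..<real m}) \<longlonglongrightarrow> measure G (\<Union>m. {- real m<..<real m})"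
      by (intro G.finite_Lim_measure_incseq) (auto simp: incseq_def)
    moreover have "(\<Union>m. {- real m<..<real m}) = UNIV"
      by (auto, meson abs_less_iff minus_less_iff reals_Archimedean2)
    ultimately have "(\<lambda>m. measure G {- real m<..<real m}) \<longlonglongrightarrow> 1"
      using G.prob_space by simp
    then have "\<forall>\<^sub>F m in sequentially. measure G {- real m<..<real m} > 1 - \<epsilon> / 2"
      using \<epsilon> by (intro order_tendstoD(1)) auto
    then obtain m where m: "measure G {- real m<..<real m} > 1 - \<epsilon> / 2"
      by (auto simp: eventually_sequentially)
    obtain k where k: "\<forall>\<^sub>F n in sequentially. measure (R n \<star> G) {-k<..k} > 1 - \<epsilon> / 2"
      using weak_conv_eventually_bounded[OF real_distribution_convolution[OF R G] \<mu> w, of "\<epsilon> / 2"] \<epsilon> by auto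
    show "\<exists>k. \<forall>\<^sub>F n in sequentially. measure (R n) {-k<..k} > 1 - \<epsilon>"
    proof (rule exI, use k in eventually_elim)
      case (elim n)
      interpret P: pair_prob_space "R n" G ..
      \<comment> \<open>If the sum lies in {-k<..k} and the second summand in {-m<..<m}, then the
        first lies in \<open>?A\<close>; mass escaping from \<open>R n\<close> would thus escape
        from the convolution.\<close>
      let ?A = "{- (k + m)<..k + m}" and ?B = "- {- real m<..<real m}"
      have "measure (R n \<star> G) {-k<..k} = measure (R n \<Otimes>\<^sub>M G) ((\<lambda>(x, y). x + y) -` {-k<..k} \<inter> space (R n \<Otimes>\<^sub>M G))"
        unfolding convolution_def by (rule measure_distr) auto
      also have "\<dots> \<le> measure (R n \<Otimes>\<^sub>M G) (?A \<times> UNIV \<union> UNIV \<times> ?B)"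
        by (rule P.finite_measure_mono) auto
      also have "\<dots> \<le> measure (R n \<Otimes>\<^sub>M G) (?A \<times> UNIV) + measure (R n \<Otimes>\<^sub>M G) (UNIV \<times> ?B)"
        by (rule measure_Un_le) auto
      also have "\<dots> = measure (R n) ?A + measure G ?B"
        using R.prob_space[of n] G.prob_space
        by (simp add: measure_def G.emeasure_pair_measure_Times enn2real_mult)
      also have "measure G ?B = 1 - measure G {- real m<..<real m}"
        using G.prob_compl[of "{- real m<..<real m}"] by (simp add: Compl_eq_Diff_UNIV)
      finally show "measure (R n) ?A > 1 - \<epsilon>" using elim m by linarith
    qed
  qed
  then obtain r M where rM: "strict_mono (r :: nat \<Rightarrow> nat)" "real_distribution M" "weak_conv_m (R \<circ> id \<circ> r) M"
    using tight_imp_convergent_subsubsequence[of R id] by (auto simp: strict_mono_id)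
  have "char M u = \<psi> u" for u
  proof (rule LIMSEQ_unique)
    show "(\<lambda>n. char ((R \<circ> id \<circ> r) n) u) \<longlonglongrightarrow> char M u"
      by (rule levy_continuity1) (use rM R in \<open>auto simp: o_def\<close>)
    show "(\<lambda>n. char ((R \<circ> id \<circ> r) n) u) \<longlonglongrightarrow> \<psi> u"
      using LIMSEQ_subseq_LIMSEQ[OF lim rM(1)] by (simp add: o_def)
  qed
  with rM show ?thesis by (intro that)
qed

text \<open>The integrand of the negative Levy-Khintchine exponent, kept literally equal to the one
  in \<open>has_local_characteristics\<close> so that unfolding identifies the two.\<close>

definition levy_kernel :: "real \<Rightarrow> real \<Rightarrow> complex" where
  "levy_kernel u y = 1 - iexp (u * y) + \<i> * of_real (u * y * indicator {-1..1} y)"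

lemma borel_measurable_levy_kernel [measurable]: "levy_kernel u \<in> borel_measurable borel"
  unfolding levy_kernel_def[abs_def] by measurable

text \<open>For \<bar>y\<bar> \<le> 1 the compensator cancels the linear Taylor term and leaves a
  remainder of at most (u y)^2 / 2; elsewhere the compensator is absent and the kernel is bounded by
  2. The constant 2 + u^2 covers both.\<close>

lemma norm_levy_kernel_le: "norm (levy_kernel u y) \<le> (2 + u\<^sup>2) * min (\<bar>y\<bar>\<^sup>2) 1"
proof (cases "\<bar>y\<bar> \<le> 1")
  case True
  have "norm (iexp (u * y) - (\<Sum>k\<le>1. (\<i> * (u * y)) ^ k / fact k)) \<le> \<bar>u * y\<bar> ^ Suc 1 / fact (Suc 1)"
    by (rule iexp_approx1)
  moreover have "levy_kernel u y = - (iexp (u * y) - (\<Sum>k\<le>1. (\<i> * (u * y)) ^ k / fact k))"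
    using True by (simp add: levy_kernel_def indicator_def abs_le_iff minus_le_iff)
  ultimately have "norm (levy_kernel u y) \<le> (u * y)\<^sup>2 / 2"
    by (simp only: norm_minus_cancel) (simp add: power2_eq_square)
  also have "\<dots> \<le> (2 + u\<^sup>2) * y\<^sup>2"
    by (simp add: power_mult_distrib field_simps)
  finally show ?thesis
    using True by (simp add: min_def abs_square_le_1)
next
  case False
  then have "levy_kernel u y = 1 - iexp (u * y)"
    by (auto simp: levy_kernel_def indicator_def)
  then have "norm (levy_kernel u y) \<le> 2"
    using norm_triangle_ineq4[of 1 "iexp (u * y)"] by simp
  also have "\<dots> \<le> 2 + u\<^sup>2" by simp
  finally show ?thesis
    using False by (simp add: min_def abs_square_le_1)
qed

context
  fixes \<nu> :: "real measure"
  assumes levy: "levy_measure \<nu>"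
begin

lemma sets_levy_measure [measurable_cong]: "sets \<nu> = sets borel"
  using levy by (simp add: levy_measure_def)

lemma integrable_min_square: "integrable \<nu> (\<lambda>y. min (\<bar>y\<bar>\<^sup>2) 1)"
  using levy by (intro integrableI_bounded) (auto simp: levy_measure_def)

lemma integrable_levy_kernel: "integrable \<nu> (levy_kernel u)"
proof (rule Bochner_Integration.integrable_bound)
  show "integrable \<nu> (\<lambda>y. (2 + u\<^sup>2) * min (\<bar>y\<bar>\<^sup>2) 1)"
    using integrable_min_square by simp
qed (auto simp: order_trans[OF norm_levy_kernel_le])

text \<open>Markov's inequality: beyond \<delta> the integrand of the Levy condition is at least min
  (\<delta>^2) 1.\<close>

lemma emeasure_levy_outside:
  assumes "0 < \<delta>"
  shows "emeasure \<nu> {y. \<delta> < \<bar>y\<bar>} < \<infinity>"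
proof -
  define c where "c = min (\<delta>\<^sup>2) 1"
  have c: "c > 0" using assms by (simp add: c_def)
  have sq: "\<delta>\<^sup>2 \<le> \<bar>y\<bar>\<^sup>2" if "\<delta> < \<bar>y\<bar>" for y :: real
    using that assms by (intro power_mono) auto
  have "ennreal c * emeasure \<nu> {y. \<delta> < \<bar>y\<bar>} = (\<integral>\<^sup>+y. ennreal c * indicator {y. \<delta> < \<bar>y\<bar>} y \<partial>\<nu>)"
    by (rule nn_integral_cmult_indicator[symmetric]) measurable
  also have "\<dots> \<le> (\<integral>\<^sup>+y. ennreal (min (\<bar>y\<bar>\<^sup>2) 1) \<partial>\<nu>)"
    by (intro nn_integral_mono) (use sq in \<open>auto simp: c_def indicator_def intro!: ennreal_leI min.coboundedI1\<close>)
  also have "\<dots> < \<infinity>" using levy by (simp add: levy_measure_def)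
  finally show ?thesis using c by (auto simp: ennreal_mult_less_top)
qed

text \<open>Provides the density of \<nu>1 with respect to \<nu>2. Mass may accumulate near 0, but 0
  itself is null and the complements of shrinking neighbourhoods have finite mass.\<close>

lemma sigma_finite_levy_measure: "sigma_finite_measure \<nu>"
proof
  let ?A = "insert {0} (range (\<lambda>n. {y. inverse (real (Suc n)) < \<bar>y\<bar>}))"
  have "\<exists>n. inverse (real (Suc n)) < \<bar>y\<bar>" if "y \<noteq> 0" for y :: real
    using that reals_Archimedean[of "\<bar>y\<bar>"] by simp
  then have "\<Union> ?A = space \<nu>"
    using sets_eq_imp_space_eq[OF sets_levy_measure] by auto
  moreover have "emeasure \<nu> a \<noteq> \<infinity>" if "a \<in> ?A" for a
    using that levy emeasure_levy_outside[of "inverse (real (Suc n))" for n]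
    by (auto simp: levy_measure_def less_top)
  ultimately show "\<exists>A. countable A \<and> A \<subseteq> sets \<nu> \<and> \<Union> A = space \<nu> \<and> (\<forall>a\<in>A. emeasure \<nu> a \<noteq> \<infinity>)"
    by (intro exI[of _ ?A]) (auto simp: sets_levy_measure)
qed

text \<open>Away from 0 the measure is finite, so the truncated exponent belongs to a compound
  Poisson law. Its compensator is integrable on its own and amounts to a shift by - \<tau> *
  m.\<close>

lemma truncated_infinitely_divisible:
  assumes "0 \<le> \<tau>" "0 < \<delta>"
  obtains R where "real_distribution R"
    "\<And>u. char R u = exp (\<i> * of_real (u * b) -
      of_real \<tau> * (CLINT y|\<nu>. indicator {y. \<delta> < \<bar>y\<bar>} y *\<^sub>R levy_kernel u y))"
proof -
  let ?S = "{y::real. \<delta> < \<bar>y\<bar>}"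
  define \<beta> where "\<beta> = density \<nu> (indicator ?S)"
  have sets_\<beta> [measurable_cong]: "sets \<beta> = sets borel" by (simp add: \<beta>_def sets_levy_measure)
  have "finite_measure \<beta>"
  proof
    have "emeasure \<beta> (space \<beta>) = emeasure \<nu> ?S"
      unfolding \<beta>_def
      by (subst emeasure_density) (auto simp flip: nn_integral_indicator intro!: nn_integral_cong simp: indicator_def)
    then show "emeasure \<beta> (space \<beta>) \<noteq> \<infinity>" using emeasure_levy_outside[OF assms(2)] by simp
  qed
  interpret finite_measure \<beta> by fact
  from compound_poisson_exists[OF \<open>finite_measure \<beta>\<close> sets_\<beta> assms(1)]
  obtain K where K: "real_distribution K"
    "\<And>u. char K u = exp (- (of_real \<tau> * (CLINT y|\<beta>. 1 - iexp (u * y))))" by metis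
  define m where "m = (LINT y|\<beta>. y * indicator {-1..1} y)"
  have i: "integrable \<beta> (\<lambda>y. y * indicator {-1..1} y)"
    by (intro integrable_const_bound[where B=1]) (auto simp: indicator_def)
  have ie: "integrable \<beta> (\<lambda>y. iexp (u * y))" for u
    by (rule integrable_const_bound[where B=1]) auto
  have int: "(CLINT y|\<nu>. indicator ?S y *\<^sub>R levy_kernel u y) = (CLINT y|\<beta>. 1 - iexp (u * y)) + \<i> * of_real (u * m)" for u
  proof -
    have "(CLINT y|\<nu>. indicator ?S y *\<^sub>R levy_kernel u y) = (CLINT y|\<beta>. levy_kernel u y)"
      unfolding \<beta>_def by (subst integral_density[symmetric]) (auto simp: ennreal_indicator)
    also have "\<dots> = (CLINT y|\<beta>. 1 - iexp (u * y)) + (CLINT y|\<beta>. \<i> * of_real (u * (y * indicator {-1..1} y)))"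
      unfolding levy_kernel_def mult.assoc
      by (intro Bochner_Integration.integral_add Bochner_Integration.integrable_diff integrable_mult_right integrable_of_real i ie) auto
    also have "(CLINT y|\<beta>. \<i> * of_real (u * (y * indicator {-1..1} y))) = \<i> * of_real (u * m)"
      unfolding m_def by (simp del: of_real_mult)
    finally show ?thesis .
  qed
  show ?thesis
  proof
    show "real_distribution (return borel (b - \<tau> * m) \<star> K)"
      by (intro real_distribution_convolution real_distribution_return K)
    show "char (return borel (b - \<tau> * m) \<star> K) u = exp (\<i> * of_real (u * b) -
      of_real \<tau> * (CLINT y|\<nu>. indicator ?S y *\<^sub>R levy_kernel u y))" for u
      unfolding char_convolution[OF real_distribution_return K(1)] char_return K(2) int
      by (simp add: exp_add[symmetric] algebra_simps)
  qed
qed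

lemma infinitely_divisible_factor_exists:
  assumes \<mu>: "real_distribution \<mu>" and G: "real_distribution G" and \<tau>: "0 \<le> \<tau>"
    and char: "\<And>u. char \<mu> u = char G u * exp (\<i> * of_real (u * b) - of_real \<tau> * (CLINT y|\<nu>. levy_kernel u y))"
  obtains R where "real_distribution R" "\<mu> = (G \<star> R)"
proof -
  let ?S = "\<lambda>n. {y::real. inverse (real (Suc n)) < \<bar>y\<bar>}"
  have "\<exists>R. real_distribution R \<and> (\<forall>u. char R u = exp (\<i> * of_real (u * b) -
      of_real \<tau> * (CLINT y|\<nu>. indicator (?S n) y *\<^sub>R levy_kernel u y)))" for n
    by (rule truncated_infinitely_divisible[OF \<tau>, of "inverse (real (Suc n))" b]) auto
  then obtain R where R: "\<And>n. real_distribution (R n)" and char_R: "\<And>n u. char (R n) u =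
      exp (\<i> * of_real (u * b) - of_real \<tau> * (CLINT y|\<nu>. indicator (?S n) y *\<^sub>R levy_kernel u y))"
    by metis
  have lim: "(\<lambda>n. char (R n) u) \<longlonglongrightarrow> exp (\<i> * of_real (u * b) - of_real \<tau> * (CLINT y|\<nu>. levy_kernel u y))" for u
    unfolding char_R
  proof (intro tendsto_intros integral_dominated_convergence[where w="\<lambda>y. norm (levy_kernel u y)"])
    show "AE y in \<nu>. (\<lambda>n. indicat_real (?S n) y *\<^sub>R levy_kernel u y) \<longlonglongrightarrow> levy_kernel u y"
    proof (rule AE_I2)
      fix y :: real
      show "(\<lambda>n. indicat_real (?S n) y *\<^sub>R levy_kernel u y) \<longlonglongrightarrow> levy_kernel u y"
      proof (cases "y = 0")
        case False
        have "\<forall>\<^sub>F n in sequentially. inverse (real (Suc n)) < \<bar>y\<bar>"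
          using False by (intro order_tendstoD(2)[OF LIMSEQ_inverse_real_of_nat]) auto
        then have "\<forall>\<^sub>F n in sequentially. indicat_real (?S n) y *\<^sub>R levy_kernel u y = levy_kernel u y"
          by eventually_elim auto
        then show ?thesis by (rule tendsto_eventually)
      qed (simp add: levy_kernel_def)
    qed
  qed (auto simp: integrable_levy_kernel indicator_def)
  obtain M where M: "real_distribution M"
    "\<And>u. char M u = exp (\<i> * of_real (u * b) - of_real \<tau> * (CLINT y|\<nu>. levy_kernel u y))"
    using deconvolution_exists[OF \<mu> G R lim char] by metis
  have "\<mu> = (G \<star> M)"
    by (intro Levy_uniqueness \<mu> real_distribution_convolution G M ext) (simp add: char_convolution G M char)
  with M show ?thesis by (intro that)
qed

end

section \<open>Total variation bounds\<close>

text \<open>On the scale of the supremum over events, hence half of \<open>L1_prob\<close>. Equality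
  of the \<sigma>-algebras is part of the notion, so that bounds can be chained and
  reversed.\<close>

definition tv_bound :: "real \<Rightarrow> 'a measure \<Rightarrow> 'a measure \<Rightarrow> bool" where
  "tv_bound c M N \<longleftrightarrow> sets M = sets N \<and> (\<forall>A\<in>sets M. \<bar>measure M A - measure N A\<bar> \<le> c)"

lemma tv_bound_trans: "tv_bound c L M \<Longrightarrow> tv_bound d M N \<Longrightarrow> tv_bound (c + d) L N"
  unfolding tv_bound_def by (smt (verit, best))

lemma tv_bound_sym: "tv_bound c M N \<Longrightarrow> tv_bound c N M"
  unfolding tv_bound_def by (auto simp: abs_minus_commute)

lemma tv_bound_mono: "tv_bound c M N \<Longrightarrow> c \<le> d \<Longrightarrow> tv_bound d M N"
  unfolding tv_bound_def by force

lemma tv_bound_distr: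
  assumes tv: "tv_bound c M N" and f: "f \<in> M \<rightarrow>\<^sub>M L"
  shows "tv_bound c (distr M L f) (distr N L f)"
proof -
  have eq: "sets M = sets N" "space M = space N"
    using tv by (auto simp: tv_bound_def dest: sets_eq_imp_space_eq)
  have g: "f \<in> N \<rightarrow>\<^sub>M L" using f by (simp add: measurable_cong_sets[OF eq(1) refl])
  show ?thesis
    using tv f g eq by (auto simp: tv_bound_def measure_distr measurable_sets)
qed

text \<open>Off \<open>N\<close> the variables agree, so {X \<in> A} lies in the union of {Y \<in>
  A} and \<open>N\<close>; exchanging the roles gives the absolute value.\<close>

lemma tv_bound_coupling:
  assumes "prob_space \<Omega>" and [measurable]: "X \<in> \<Omega> \<rightarrow>\<^sub>M L" "Y \<in> \<Omega> \<rightarrow>\<^sub>M L" "N \<in> sets \<Omega>"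
    and eq: "\<And>\<omega>. \<omega> \<in> space \<Omega> \<Longrightarrow> \<omega> \<notin> N \<Longrightarrow> X \<omega> = Y \<omega>"
  shows "tv_bound (measure \<Omega> N) (distr \<Omega> L X) (distr \<Omega> L Y)"
proof -
  interpret prob_space \<Omega> by fact
  have le: "prob (X -` A \<inter> space \<Omega>) \<le> prob (Y -` A \<inter> space \<Omega>) + prob N"
    if X: "X \<in> \<Omega> \<rightarrow>\<^sub>M L" and Y: "Y \<in> \<Omega> \<rightarrow>\<^sub>M L" and A: "A \<in> sets L"
      and eq: "\<And>\<omega>. \<omega> \<in> space \<Omega> \<Longrightarrow> \<omega> \<notin> N \<Longrightarrow> X \<omega> = Y \<omega>" for X Y A
  proof -
    have "prob (X -` A \<inter> space \<Omega>) \<le> prob ((Y -` A \<inter> space \<Omega>) \<union> N)"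
      using eq Y A by (intro finite_measure_mono) auto
    also have "\<dots> \<le> prob (Y -` A \<inter> space \<Omega>) + prob N"
      using Y A by (intro measure_Un_le) auto
    finally show ?thesis .
  qed
  show ?thesis
    unfolding tv_bound_def
  proof (intro conjI ballI)
    fix A assume "A \<in> sets (distr \<Omega> L X)"
    then have A: "A \<in> sets L" by simp
    show "\<bar>measure (distr \<Omega> L X) A - measure (distr \<Omega> L Y) A\<bar> \<le> prob N"
      using le[of X Y A] le[of Y X A] eq A by (simp add: measure_distr abs_le_iff)
  qed simp
qed

text \<open>Passing from an arbitrary event to the Neyman-Pearson set \<open>H\<close> drops points
  with h \<le> 1 and gains points with h > 1. Neither change decreases the difference of the
  measures, so \<open>H\<close> maximises it.\<close>

lemma tv_bound_density:
  assumes M: "prob_space M" and D: "prob_space (density M h)" and [measurable]: "h \<in> borel_measurable M"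
  defines "H \<equiv> {x \<in> space M. 1 < h x}"
  shows "tv_bound (measure (density M h) H - measure M H) M (density M h)"
proof -
  interpret M: prob_space M by fact
  interpret D: prob_space "density M h" by fact
  have H[measurable]: "H \<in> sets M" by (simp add: H_def)
  have em: "emeasure (density M h) A = (\<integral>\<^sup>+x. h x * indicator A x \<partial>M)" if "A \<in> sets M" for A
    using that by (simp add: emeasure_density)
  have le: "measure (density M h) A - measure M A \<le> measure (density M h) H - measure M H"
    if A[measurable]: "A \<in> sets M" for A
  proof -
    have 1: "measure M (H - A) \<le> measure (density M h) (H - A)"
    proof -
      have "emeasure M (H - A) = (\<integral>\<^sup>+x. indicator (H - A) x \<partial>M)" by simp
      also have "\<dots> \<le> (\<integral>\<^sup>+x. h x * indicator (H - A) x \<partial>M)"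
        by (rule nn_integral_mono) (auto simp: H_def indicator_def)
      finally show ?thesis by (simp add: em[symmetric] M.emeasure_eq_measure D.emeasure_eq_measure)
    qed
    have 2: "measure (density M h) (A - H) \<le> measure M (A - H)"
    proof -
      have "(\<integral>\<^sup>+x. h x * indicator (A - H) x \<partial>M) \<le> (\<integral>\<^sup>+x. indicator (A - H) x \<partial>M)"
        by (rule nn_integral_mono) (auto simp: H_def indicator_def)
      also have "\<dots> = emeasure M (A - H)" by simp
      finally show ?thesis by (simp add: em[symmetric] M.emeasure_eq_measure D.emeasure_eq_measure)
    qed
    have "measure M A = measure M (A - H) + measure M (A \<inter> H)" "measure M H = measure M (H - A) + measure M (A \<inter> H)"
      by (subst M.finite_measure_Union[symmetric]; auto intro!: arg_cong[where f="measure M"])+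
    moreover have "measure (density M h) A = measure (density M h) (A - H) + measure (density M h) (A \<inter> H)"
      "measure (density M h) H = measure (density M h) (H - A) + measure (density M h) (A \<inter> H)"
      by (subst D.finite_measure_Union[symmetric]; auto intro!: arg_cong[where f="measure (density M h)"])+
    ultimately show ?thesis using 1 2 by linarith
  qed
  show ?thesis
    unfolding tv_bound_def
  proof (intro conjI ballI)
    fix A assume A: "A \<in> sets M"
    \<comment> \<open>Complements reverse the sign of the difference, as both measures have total
      mass 1.\<close>
    then have "measure (density M h) (space M - A) - measure M (space M - A) \<le> measure (density M h) H - measure M H"
      by (intro le) auto
    moreover have "measure M (space M - A) = 1 - measure M A" using A by (rule M.prob_compl)
    moreover have "measure (density M h) (space M - A) = 1 - measure (density M h) A"
      using D.prob_compl[of A] A by simp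
    ultimately show "\<bar>measure M A - measure (density M h) A\<bar> \<le> measure (density M h) H - measure M H"
      using le[OF A] by linarith
  qed simp
qed

section \<open>Independent pairs and coordinatewise convolution of product laws\<close>

lemma prob_space_pair: "prob_space M \<Longrightarrow> prob_space N \<Longrightarrow> prob_space (M \<Otimes>\<^sub>M N)"
proof -
  assume "prob_space M" "prob_space N"
  then interpret pair_prob_space M N
    by (simp add: pair_prob_space_def pair_sigma_finite_def prob_space_imp_sigma_finite)
  show ?thesis by (rule P.prob_space_axioms)
qed

lemma distr_pair_fst_prob:
  assumes "prob_space M" "prob_space N"
  shows "distr (M \<Otimes>\<^sub>M N) M fst = M"
  using assms prob_space.distr_pair_fst by blast

lemma distr_pair_snd_prob:
  assumes "prob_space M" "prob_space N"
  shows "distr (M \<Otimes>\<^sub>M N) N snd = N"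
proof -
  interpret N: prob_space N by fact
  interpret M: prob_space M by fact
  interpret P: pair_prob_space M N ..
  show ?thesis
  proof (rule measure_eqI)
    fix A assume "A \<in> sets (distr (M \<Otimes>\<^sub>M N) N snd)"
    then have A: "A \<in> sets N" by simp
    have "snd -` A \<inter> space (M \<Otimes>\<^sub>M N) = space M \<times> A"
      using sets.sets_into_space[OF A] by (auto simp: space_pair_measure)
    then show "emeasure (distr (M \<Otimes>\<^sub>M N) N snd) A = emeasure N A"
      using A by (simp add: emeasure_distr N.emeasure_pair_measure_Times M.emeasure_space_1)
  qed simp
qed

lemma measurable_add_real_distribution:
  assumes "real_distribution M" "real_distribution N"
  shows "(\<lambda>(x, y). x + y) \<in> M \<Otimes>\<^sub>M N \<rightarrow>\<^sub>M borel"
proof -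
  have "sets (M \<Otimes>\<^sub>M N) = sets (borel \<Otimes>\<^sub>M borel)"
    using assms by (intro sets_pair_measure_cong real_distribution.events_eq_borel)
  then show ?thesis by (subst measurable_cong_sets[OF _ refl]) measurable
qed

text \<open>Places the laws with and without the added summand on one space of independent pairs, as
  required for a coupling.\<close>

lemma PiM_convolution:
  assumes I: "finite I" and M: "\<And>i. real_distribution (M i)" and K: "\<And>i. real_distribution (K i)"
  shows "PiM I (\<lambda>i. M i \<star> K i) = distr (PiM I (\<lambda>i. M i \<Otimes>\<^sub>M K i)) (PiM I (\<lambda>_. borel)) (compose I (\<lambda>(x, y). x + y))"
proof -
  interpret M: real_distribution "M i" for i by (rule M)
  interpret K: real_distribution "K i" for i by (rule K)
  have "distr (PiM I (\<lambda>i. M i \<Otimes>\<^sub>M K i)) (PiM I (\<lambda>i. M i \<star> K i)) (compose I (\<lambda>(x, y). x + y)) =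
    PiM I (\<lambda>i. distr (M i \<Otimes>\<^sub>M K i) (M i \<star> K i) (\<lambda>(x, y). x + y))"
    using real_distribution_convolution[OF M K]
    by (intro distr_PiM_finite_prob_space' I prob_space_pair M.prob_space_axioms K.prob_space_axioms)
      (auto simp: real_distribution_def measurable_add_real_distribution[OF M K])
  also have "(\<lambda>i. distr (M i \<Otimes>\<^sub>M K i) (M i \<star> K i) (\<lambda>(x, y). x + y)) = (\<lambda>i. M i \<star> K i)"
    by (intro ext) (auto simp: convolution_def intro!: distr_cong)
  also have "distr (PiM I (\<lambda>i. M i \<Otimes>\<^sub>M K i)) (PiM I (\<lambda>i. M i \<star> K i)) (compose I (\<lambda>(x, y). x + y)) =
    distr (PiM I (\<lambda>i. M i \<Otimes>\<^sub>M K i)) (PiM I (\<lambda>_. borel)) (compose I (\<lambda>(x, y). x + y))"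
    by (intro distr_cong sets_PiM_cong) auto
  finally show ?thesis by simp
qed

lemma measurable_compose_PiM:
  assumes "\<And>i. i \<in> I \<Longrightarrow> f \<in> M i \<rightarrow>\<^sub>M N i"
  shows "compose I f \<in> PiM I M \<rightarrow>\<^sub>M PiM I N"
  unfolding compose_def using assms by measurable

text \<open>On the product of pairs, first components and sums coincide unless some second component
  is nonzero. The coupling inequality and the union bound over coordinates give the sum.\<close>

lemma tv_bound_PiM_convolution:
  assumes I: "finite I" and M: "\<And>i. real_distribution (M i)" and K: "\<And>i. real_distribution (K i)"
  shows "tv_bound (\<Sum>i\<in>I. measure (K i) (- {0})) (PiM I M) (PiM I (\<lambda>i. M i \<star> K i))"
proof -
  interpret M: real_distribution "M i" for i by (rule M)
  interpret K: real_distribution "K i" for i by (rule K)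
  define \<Omega> where "\<Omega> = PiM I (\<lambda>i. M i \<Otimes>\<^sub>M K i)"
  have pair: "prob_space (M i \<Otimes>\<^sub>M K i)" for i
    by (intro prob_space_pair M.prob_space_axioms K.prob_space_axioms)
  interpret \<Omega>: prob_space \<Omega> unfolding \<Omega>_def by (intro prob_space_PiM pair)
  have fst: "PiM I M = distr \<Omega> (PiM I (\<lambda>_. borel)) (compose I fst)"
  proof -
    have "distr \<Omega> (PiM I M) (compose I fst) = PiM I (\<lambda>i. distr (M i \<Otimes>\<^sub>M K i) (M i) fst)"
      unfolding \<Omega>_def by (intro distr_PiM_finite_prob_space' I pair M.prob_space_axioms) auto
    also have "\<dots> = PiM I M"
      by (simp add: distr_pair_fst_prob M.prob_space_axioms K.prob_space_axioms)
    also have "distr \<Omega> (PiM I M) (compose I fst) = distr \<Omega> (PiM I (\<lambda>_. borel)) (compose I fst)"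
      by (intro distr_cong sets_PiM_cong) auto
    finally show ?thesis by simp
  qed
  have m[measurable]: "compose I fst \<in> \<Omega> \<rightarrow>\<^sub>M PiM I (\<lambda>_. borel)"
    "compose I (\<lambda>(x, y). x + y) \<in> \<Omega> \<rightarrow>\<^sub>M PiM I (\<lambda>_. borel)"
    unfolding \<Omega>_def using measurable_add_real_distribution[OF M K] measurable_fst[of "M i" "K i" for i]
    by (auto intro!: measurable_compose_PiM simp: measurable_cong_sets[OF refl M.events_eq_borel])
  define N where "N i = (\<lambda>\<omega>. snd (\<omega> i)) -` (- {0}) \<inter> space \<Omega>" for i
  have sm[measurable]: "(\<lambda>\<omega>. snd (\<omega> i)) \<in> \<Omega> \<rightarrow>\<^sub>M borel" if "i \<in> I" for i
    using that measurable_snd[of "M i" "K i"] unfolding \<Omega>_def measurable_cong_sets[OF refl K.events_eq_borel]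
    by (rule measurable_compose[OF measurable_component_singleton])
  have N: "N i \<in> sets \<Omega>" if "i \<in> I" for i
    using that unfolding N_def by (intro measurable_sets[OF sm]) auto
  have mN: "measure \<Omega> (N i) = measure (K i) (- {0})" if "i \<in> I" for i
  proof -
    have "K i = distr (distr \<Omega> (M i \<Otimes>\<^sub>M K i) (\<lambda>\<omega>. \<omega> i)) (K i) snd"
      unfolding \<Omega>_def using distr_PiM_component[where M="\<lambda>i. M i \<Otimes>\<^sub>M K i", OF pair that]
      by (simp add: distr_pair_snd_prob M.prob_space_axioms K.prob_space_axioms)
    also have "\<dots> = distr \<Omega> (K i) (\<lambda>\<omega>. snd (\<omega> i))"
      using that measurable_snd[of "M i" "K i"]
      by (subst distr_distr) (auto simp: \<Omega>_def o_def measurable_cong_sets[OF refl K.events_eq_borel])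
    finally have "measure (K i) (- {0}) = measure (distr \<Omega> (K i) (\<lambda>\<omega>. snd (\<omega> i))) (- {0})" by simp
    also have "\<dots> = measure \<Omega> (N i)"
      unfolding N_def using sm[OF that]
      by (intro measure_distr) (auto simp: measurable_cong_sets[OF refl K.events_eq_borel])
    finally show ?thesis by simp
  qed
  have "tv_bound (measure \<Omega> (\<Union>i\<in>I. N i)) (PiM I M) (PiM I (\<lambda>i. M i \<star> K i))"
    unfolding fst PiM_convolution[OF I M K] \<Omega>_def[symmetric]
  proof (rule tv_bound_coupling)
    show "(\<Union>i\<in>I. N i) \<in> sets \<Omega>" using N I by auto
    fix \<omega> assume "\<omega> \<in> space \<Omega>" "\<omega> \<notin> (\<Union>i\<in>I. N i)"
    then show "compose I fst \<omega> = compose I (\<lambda>(x, y). x + y) \<omega>"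
      by (auto simp: compose_def N_def fun_eq_iff split_beta)
  qed (simp_all add: \<Omega>.prob_space_axioms)
  moreover have "measure \<Omega> (\<Union>i\<in>I. N i) \<le> (\<Sum>i\<in>I. measure (K i) (- {0}))"
    using measure_UNION_le[OF I, of N \<Omega>] N by (simp add: mN)
  ultimately show ?thesis by (rule tv_bound_mono)
qed

section \<open>Shifted Gaussian product laws\<close>

lemma PiM_density:
  assumes I: "finite I" and M: "\<And>i. prob_space (M i)"
    and h[measurable]: "\<And>i. h i \<in> borel_measurable (M i)" and D: "\<And>i. prob_space (density (M i) (h i))"
  shows "PiM I (\<lambda>i. density (M i) (h i)) = density (PiM I M) (\<lambda>\<omega>. \<Prod>i\<in>I. h i (\<omega> i))"
proof -
  interpret D: product_sigma_finite "\<lambda>i. density (M i) (h i)"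
    by (simp add: product_sigma_finite_def prob_space_imp_sigma_finite D)
  interpret M: product_sigma_finite M
    by (simp add: product_sigma_finite_def prob_space_imp_sigma_finite M)
  have meas: "(\<lambda>\<omega>. \<Prod>i\<in>I. h i (\<omega> i)) \<in> borel_measurable (PiM I M)"
  proof (rule borel_measurable_prod_ennreal)
    fix i assume "i \<in> I"
    then have "(\<lambda>\<omega>. \<omega> i) \<in> PiM I M \<rightarrow>\<^sub>M M i" by measurable
    from measurable_compose[OF this h] show "(\<lambda>\<omega>. h i (\<omega> i)) \<in> borel_measurable (PiM I M)" .
  qed
  show ?thesis
  proof (rule D.PiM_eqI[symmetric, OF I])
    show "sets (density (PiM I M) (\<lambda>\<omega>. \<Prod>i\<in>I. h i (\<omega> i))) = sets (PiM I (\<lambda>i. density (M i) (h i)))"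
      by (simp cong: sets_PiM_cong)
    fix A assume "\<And>i. i \<in> I \<Longrightarrow> A i \<in> sets (density (M i) (h i))"
    then have A: "\<And>i. i \<in> I \<Longrightarrow> A i \<in> sets (M i)" by simp
    have "emeasure (density (PiM I M) (\<lambda>\<omega>. \<Prod>i\<in>I. h i (\<omega> i))) (Pi\<^sub>E I A) =
      (\<integral>\<^sup>+\<omega>. (\<Prod>i\<in>I. h i (\<omega> i)) * indicator (Pi\<^sub>E I A) \<omega> \<partial>PiM I M)"
      using A I by (subst emeasure_density[OF meas]) (auto intro!: sets_PiM_I_finite)
    also have "\<dots> = (\<integral>\<^sup>+\<omega>. (\<Prod>i\<in>I. h i (\<omega> i) * indicator (A i) (\<omega> i)) \<partial>PiM I M)"
    proof (rule nn_integral_cong)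
      fix \<omega> assume "\<omega> \<in> space (PiM I M)"
      then have "(indicator (Pi\<^sub>E I A) \<omega> :: ennreal) = (\<Prod>i\<in>I. indicator (A i) (\<omega> i))"
        using I by (auto simp: indicator_def PiE_iff space_PiM prod_zero_iff)
      then show "(\<Prod>i\<in>I. h i (\<omega> i)) * indicator (Pi\<^sub>E I A) \<omega> = (\<Prod>i\<in>I. h i (\<omega> i) * indicator (A i) (\<omega> i))"
        by (simp add: prod.distrib)
    qed
    also have "\<dots> = (\<Prod>i\<in>I. \<integral>\<^sup>+x. h i x * indicator (A i) x \<partial>M i)"
      using A by (intro M.product_nn_integral_prod I) auto
    also have "\<dots> = (\<Prod>i\<in>I. emeasure (density (M i) (h i)) (A i))"
      using A by (intro prod.cong refl) (simp add: emeasure_density)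
    finally show "emeasure (density (PiM I M) (\<lambda>\<omega>. \<Prod>i\<in>I. h i (\<omega> i))) (Pi\<^sub>E I A) =
      (\<Prod>i\<in>I. emeasure (density (M i) (h i)) (A i))" .
  qed
qed

lemma indep_vars_PiM_component:
  assumes "I \<noteq> {}" and M: "\<And>i. prob_space (M i)"
  shows "prob_space.indep_vars (PiM I M) M (\<lambda>i \<omega>. \<omega> i) I"
proof -
  interpret prob_space "PiM I M" by (intro prob_space_PiM M)
  have "distr (PiM I M) (PiM I M) (\<lambda>\<omega>. \<lambda>i\<in>I. \<omega> i) = distr (PiM I M) (PiM I M) (\<lambda>\<omega>. \<omega>)"
    by (intro distr_cong) (auto simp: space_PiM PiE_restrict)
  also have "\<dots> = PiM I (\<lambda>i. distr (PiM I M) (M i) (\<lambda>\<omega>. \<omega> i))"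
    by (simp add: distr_id2 M distr_PiM_component cong: PiM_cong)
  finally show ?thesis
    using assms(1) by (subst indep_vars_iff_distr_eq_PiM') auto
qed

text \<open>An affine image rather than a density, so that variance 0 yields a unit mass. That case
  arises for the log-likelihood ratio when all shifts vanish.\<close>

definition gauss :: "real \<Rightarrow> real \<Rightarrow> real measure" where
  "gauss m v = distr std_normal_distribution borel (\<lambda>x. m + sqrt v * x)"

lemma real_distribution_distr_std_normal:
  assumes [measurable]: "f \<in> borel_measurable borel"
  shows "real_distribution (distr std_normal_distribution borel f)"
proof -
  interpret real_distribution std_normal_distribution by (rule real_dist_normal_dist)
  show ?thesis by (rule real_distribution_distr) simp
qed

lemma real_distribution_gauss: "real_distribution (gauss m v)"
  unfolding gauss_def by (rule real_distribution_distr_std_normal) measurable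

lemma char_affine_std_normal:
  "char (distr std_normal_distribution borel (\<lambda>x. a + b * x)) u = iexp (u * a) * exp (- of_real (u\<^sup>2 * b\<^sup>2 / 2))"
proof -
  have "char (distr std_normal_distribution borel (\<lambda>x. a + b * x)) u =
    (CLINT x|std_normal_distribution. iexp (u * a) * iexp ((u * b) * x))"
    unfolding char_def by (subst integral_distr) (auto simp: algebra_simps exp_add[symmetric])
  also have "\<dots> = iexp (u * a) * char std_normal_distribution (u * b)"
    unfolding char_def by (rule integral_mult_right_zero)
  finally show ?thesis
    by (simp only: char_std_normal_distribution exp_of_real[symmetric]) (simp add: power_mult_distrib)
qed

lemma char_gauss: "0 \<le> v \<Longrightarrow> char (gauss m v) u = iexp (u * m) * exp (- of_real (u\<^sup>2 * v / 2))"
  unfolding gauss_def by (simp add: char_affine_std_normal del: of_real_mult of_real_divide)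

lemma gauss_eq_density:
  assumes "0 < v"
  shows "gauss m v = density lborel (normal_density m (sqrt v))"
proof -
  interpret real_distribution std_normal_distribution by (rule real_dist_normal_dist)
  have "distributed std_normal_distribution lborel (\<lambda>x. x) std_normal_density"
    by (auto simp: distributed_def distr_id2)
  from normal_density_affine[OF this, of "sqrt v" m] assms
  have "distributed std_normal_distribution lborel (\<lambda>x. m + sqrt v * x) (normal_density m (sqrt v))" by simp
  then have "distr std_normal_distribution lborel (\<lambda>x. m + sqrt v * x) = density lborel (normal_density m (sqrt v))"
    by (simp add: distributed_def)
  then show ?thesis unfolding gauss_def by (simp cong: distr_cong)
qed

text \<open>Completing the square: - (x - d)^2 / (2 v) = - x^2 / (2 v) + (d x - d^2 / 2) /
  v.\<close>

lemma gauss_shift_density: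
  assumes v: "0 < v"
  shows "gauss d v = density (gauss 0 v) (\<lambda>x. ennreal (exp ((d * x - d\<^sup>2 / 2) / v)))"
proof -
  have "normal_density d (sqrt v) x = normal_density 0 (sqrt v) x * exp ((d * x - d\<^sup>2 / 2) / v)" for x
  proof -
    have "- (x - d)\<^sup>2 / (2 * v) = - x\<^sup>2 / (2 * v) + (d * x - d\<^sup>2 / 2) / v"
      using v by (simp add: field_simps power2_eq_square)
    then show ?thesis
      using v by (simp add: normal_density_def exp_add[symmetric])
  qed
  then show ?thesis
    using v by (simp only: gauss_eq_density) (subst density_density_eq, auto simp: ennreal_mult)
qed

lemma measure_gauss_pos:
  assumes v: "0 < v"
  shows "measure (gauss m v) {0<..} = 1 - cdf std_normal_distribution (- m / sqrt v)"
proof -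
  interpret real_distribution std_normal_distribution by (rule real_dist_normal_dist)
  have "(\<lambda>x. m + sqrt v * x) -` {0<..} = UNIV - {..- m / sqrt v}"
    using v by (auto simp: field_simps)
  then show ?thesis
    using prob_compl[of "{..- m / sqrt v}"] by (simp add: gauss_def measure_distr cdf_def)
qed

text \<open>Mean over standard deviation is \<xi> / 2 for one law and - \<xi> / 2 for the other. For
  \<xi> = 0 the two laws coincide and nothing has to be standardised.\<close>

lemma measure_gauss_pos_diff:
  assumes "0 \<le> \<xi>"
  shows "measure (gauss (\<xi>\<^sup>2 / 2) (\<xi>\<^sup>2)) {0<..} - measure (gauss (- \<xi>\<^sup>2 / 2) (\<xi>\<^sup>2)) {0<..} =
    cdf std_normal_distribution (\<xi> / 2) - cdf std_normal_distribution (- \<xi> / 2)"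
proof (cases "\<xi> = 0")
  case False
  then have "0 < \<xi>\<^sup>2" by simp
  then show ?thesis
    using assms False by (simp add: measure_gauss_pos) (simp add: power2_eq_square)
qed simp

text \<open>The log-likelihood ratio of the two Gaussian factors is normal with variance
  \<open>\<xi>\<^sup>2\<close> and mean \<open>- \<xi>\<^sup>2 / 2\<close> or \<open>\<xi>\<^sup>2 / 2\<close> under the two laws, and the total variation distance is
  attained on the set where it is positive.\<close>

lemma tv_bound_PiM_gauss_shift:
  fixes d v :: "'i \<Rightarrow> real"
  assumes I: "finite I" "I \<noteq> {}" and v: "\<And>i. 0 < v i" and R: "\<And>i. real_distribution (R i)"
  defines "\<xi> \<equiv> sqrt (\<Sum>i\<in>I. (d i)\<^sup>2 / v i)"
  shows "tv_bound (cdf std_normal_distribution (\<xi> / 2) - cdf std_normal_distribution (- \<xi> / 2))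
    (PiM I (\<lambda>i. gauss 0 (v i) \<star> R i)) (PiM I (\<lambda>i. gauss (d i) (v i) \<star> R i))"
proof -
  have \<xi>: "0 \<le> \<xi>" "\<xi>\<^sup>2 = (\<Sum>i\<in>I. (d i)\<^sup>2 / v i)"
    using v by (auto simp: \<xi>_def less_imp_le intro!: sum_nonneg)
  interpret R: real_distribution "R i" for i by (rule R)
  interpret G: real_distribution "gauss m w" for m w by (rule real_distribution_gauss)
  \<comment> \<open>The factors \<open>R i\<close> may lack densities. Kept as second components
    with the same law on both sides, they drop out of the likelihood ratio, whose logarithm is then
    the sum of the \<open>l i\<close> at the first components.\<close>
  define \<Omega> where "\<Omega> m = PiM I (\<lambda>i. gauss (m i) (v i) \<Otimes>\<^sub>M R i)" for m
  define l where "l i x = (d i * x - (d i)\<^sup>2 / 2) / v i" for i x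
  have l[measurable]: "l i \<in> borel_measurable borel" for i unfolding l_def by measurable
  have pair: "prob_space (gauss m w \<Otimes>\<^sub>M R i)" for m w i
    by (intro prob_space_pair R.prob_space_axioms G.prob_space_axioms)
  have \<Omega>_prob: "prob_space (\<Omega> m)" for m
    unfolding \<Omega>_def by (intro prob_space_PiM pair)
  have fstm: "fst \<in> gauss m w \<Otimes>\<^sub>M R i \<rightarrow>\<^sub>M borel" for m w i
    using measurable_fst[of "gauss m w" "R i"] by (simp add: measurable_cong_sets[OF refl G.events_eq_borel])
  have comp: "(\<lambda>\<omega>. fst (\<omega> i)) \<in> \<Omega> m \<rightarrow>\<^sub>M borel" if "i \<in> I" for i m
    unfolding \<Omega>_def by (rule measurable_compose[OF measurable_component_singleton[OF that] fstm])
  have dens_pair: "gauss (d i) (v i) \<Otimes>\<^sub>M R i = density (gauss 0 (v i) \<Otimes>\<^sub>M R i) (\<lambda>p. ennreal (exp (l i (fst p))))" for i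
  proof -
    have "gauss (d i) (v i) \<Otimes>\<^sub>M R i = density (gauss 0 (v i)) (\<lambda>x. ennreal (exp (l i x))) \<Otimes>\<^sub>M density (R i) (\<lambda>_. 1)"
      unfolding density_1 l_def by (subst gauss_shift_density[OF v]) (rule refl)
    also have "\<dots> = density (gauss 0 (v i) \<Otimes>\<^sub>M R i) (\<lambda>(x, y). ennreal (exp (l i x)) * 1)"
      by (rule pair_measure_density) (auto simp: density_1 R.sigma_finite_measure_axioms)
    finally show ?thesis by (simp add: case_prod_beta')
  qed
  have "\<Omega> d = density (\<Omega> (\<lambda>_. 0)) (\<lambda>\<omega>. \<Prod>i\<in>I. ennreal (exp (l i (fst (\<omega> i)))))"
    unfolding \<Omega>_def dens_pair
    by (rule PiM_density[OF I(1) pair])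
      (auto simp: dens_pair[symmetric] pair intro!: measurable_compose[OF fstm])
  also have "(\<lambda>\<omega>. \<Prod>i\<in>I. ennreal (exp (l i (fst (\<omega> i))))) = (\<lambda>\<omega>. ennreal (exp (\<Sum>i\<in>I. l i (fst (\<omega> i)))))"
    using I by (auto simp: exp_sum prod_ennreal)
  finally have dens: "\<Omega> d = density (\<Omega> (\<lambda>_. 0)) (\<lambda>\<omega>. ennreal (exp (\<Sum>i\<in>I. l i (fst (\<omega> i)))))" .
  define S where "S \<omega> = (\<Sum>i\<in>I. l i (fst (\<omega> i)))" for \<omega> :: "'i \<Rightarrow> real \<times> real"
  have S[measurable]: "S \<in> \<Omega> m \<rightarrow>\<^sub>M borel" for m
    unfolding S_def by (intro borel_measurable_sum measurable_compose[OF comp l])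
  \<comment> \<open>One computation for arbitrary means; m = 0 and m = d yield the laws of the
    log-likelihood ratio under the two product laws.\<close>
  have law: "distr (\<Omega> m) borel S = gauss (\<Sum>i\<in>I. (d i * m i - (d i)\<^sup>2 / 2) / v i) (\<xi>\<^sup>2)" for m
  proof (rule Levy_uniqueness)
    interpret \<Omega>: prob_space "\<Omega> m" by (rule \<Omega>_prob)
    show "real_distribution (distr (\<Omega> m) borel S)" by (rule \<Omega>.real_distribution_distr) simp
    have ind: "\<Omega>.indep_vars (\<lambda>_. borel) (\<lambda>i \<omega>. l i (fst (\<omega> i))) I"
      unfolding \<Omega>_def
      by (rule prob_space.indep_vars_compose2[OF prob_space_PiM[OF pair] indep_vars_PiM_component[OF I(2) pair]])
        (intro measurable_compose[OF fstm l])
    have comp_law: "distr (\<Omega> m) borel (\<lambda>\<omega>. l i (fst (\<omega> i))) = distr std_normal_distribution borel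
        (\<lambda>x. (d i * m i - (d i)\<^sup>2 / 2) / v i + (d i * sqrt (v i) / v i) * x)" if "i \<in> I" for i
    proof -
      have "gauss (m i) (v i) = distr (gauss (m i) (v i) \<Otimes>\<^sub>M R i) (gauss (m i) (v i)) fst"
        by (simp add: distr_pair_fst_prob R.prob_space_axioms G.prob_space_axioms)
      also have "gauss (m i) (v i) \<Otimes>\<^sub>M R i = distr (\<Omega> m) (gauss (m i) (v i) \<Otimes>\<^sub>M R i) (\<lambda>\<omega>. \<omega> i)"
        unfolding \<Omega>_def
        using distr_PiM_component[where M="\<lambda>i. gauss (m i) (v i) \<Otimes>\<^sub>M R i", OF pair that] by simp
      finally have "gauss (m i) (v i) = distr (\<Omega> m) (gauss (m i) (v i)) (\<lambda>\<omega>. fst (\<omega> i))"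
        using that by (subst (asm) distr_distr) (auto simp: \<Omega>_def o_def)
      then have "distr (gauss (m i) (v i)) borel (l i) = distr (distr (\<Omega> m) (gauss (m i) (v i)) (\<lambda>\<omega>. fst (\<omega> i))) borel (l i)"
        by simp
      also have "\<dots> = distr (\<Omega> m) borel (\<lambda>\<omega>. l i (fst (\<omega> i)))"
        using comp[OF that] by (subst distr_distr) (auto simp: o_def measurable_cong_sets[OF refl G.events_eq_borel])
      finally have "distr (\<Omega> m) borel (\<lambda>\<omega>. l i (fst (\<omega> i))) = distr (gauss (m i) (v i)) borel (l i)" ..
      also have "\<dots> = distr std_normal_distribution borel (\<lambda>x. l i (m i + sqrt (v i) * x))"
        unfolding gauss_def by (subst distr_distr) (auto simp: o_def)
      also have "(\<lambda>x. l i (m i + sqrt (v i) * x)) = (\<lambda>x. (d i * m i - (d i)\<^sup>2 / 2) / v i + (d i * sqrt (v i) / v i) * x)"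
        using v[of i] by (auto simp: l_def field_simps)
      finally show ?thesis .
    qed
    show "char (distr (\<Omega> m) borel S) = char (gauss (\<Sum>i\<in>I. (d i * m i - (d i)\<^sup>2 / 2) / v i) (\<xi>\<^sup>2))"
    proof
      fix u
      have sq: "(d i * sqrt (v i) / v i)\<^sup>2 = (d i)\<^sup>2 / v i" for i
        using v[of i] by (simp add: power_mult_distrib power_divide) (simp add: power2_eq_square)
      have "char (distr (\<Omega> m) borel S) u = (\<Prod>i\<in>I. iexp (u * ((d i * m i - (d i)\<^sup>2 / 2) / v i)) * exp (- of_real (u\<^sup>2 * ((d i)\<^sup>2 / v i) / 2)))"
        unfolding S_def \<Omega>.char_distr_sum[OF ind]
        by (intro prod.cong refl) (simp only: comp_law char_affine_std_normal sq)
      also have "\<dots> = iexp (u * (\<Sum>i\<in>I. (d i * m i - (d i)\<^sup>2 / 2) / v i)) * exp (- of_real (u\<^sup>2 * \<xi>\<^sup>2 / 2))"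
        unfolding \<xi>(2) prod.distrib using I(1)
        by (simp only: exp_sum[symmetric] sum_distrib_left sum_divide_distrib of_real_sum sum_negf[symmetric])
      finally show "char (distr (\<Omega> m) borel S) u = char (gauss (\<Sum>i\<in>I. (d i * m i - (d i)\<^sup>2 / 2) / v i) (\<xi>\<^sup>2)) u"
        by (simp only: char_gauss zero_le_power2)
    qed
  qed (rule real_distribution_gauss)
  have "(\<Sum>i\<in>I. (d i * 0 - (d i)\<^sup>2 / 2) / v i) = - \<xi>\<^sup>2 / 2" "(\<Sum>i\<in>I. (d i * d i - (d i)\<^sup>2 / 2) / v i) = \<xi>\<^sup>2 / 2"
    unfolding \<xi>(2) by (simp_all add: sum_divide_distrib sum_negf[symmetric] power2_eq_square diff_divide_distrib mult.commute[of 2])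
  note law0 = law[of "\<lambda>_. 0", unfolded this] and law1 = law[of d, unfolded this]
  have H: "measure (\<Omega> m) {\<omega> \<in> space (\<Omega> (\<lambda>_. 0)). 1 < ennreal (exp (S \<omega>))} = measure (distr (\<Omega> m) borel S) {0<..}"
    if "space (\<Omega> m) = space (\<Omega> (\<lambda>_. 0))" for m
  proof -
    have "1 < ennreal (exp x) \<longleftrightarrow> 0 < x" for x
      using ennreal_less_iff[of 1 "exp x"] by simp
    then show ?thesis
      using that by (subst measure_distr) (auto intro!: arg_cong[where f="measure (\<Omega> m)"])
  qed
  have "tv_bound (measure (\<Omega> d) {\<omega> \<in> space (\<Omega> (\<lambda>_. 0)). 1 < ennreal (exp (S \<omega>))}
      - measure (\<Omega> (\<lambda>_. 0)) {\<omega> \<in> space (\<Omega> (\<lambda>_. 0)). 1 < ennreal (exp (S \<omega>))}) (\<Omega> (\<lambda>_. 0)) (\<Omega> d)"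
    using \<Omega>_prob[of d] unfolding dens S_def[symmetric] by (intro tv_bound_density \<Omega>_prob) auto
  moreover have "space (\<Omega> d) = space (\<Omega> (\<lambda>_. 0))" by (simp add: dens)
  ultimately have "tv_bound (cdf std_normal_distribution (\<xi> / 2) - cdf std_normal_distribution (- \<xi> / 2)) (\<Omega> (\<lambda>_. 0)) (\<Omega> d)"
    by (simp only: H law0 law1 measure_gauss_pos_diff[OF \<xi>(1)])
  \<comment> \<open>Adding the two components is a measurable map and cannot increase total
    variation, so the bound passes from pairs to convolutions.\<close>
  moreover have "PiM I (\<lambda>i. gauss (m i) (v i) \<star> R i) = distr (\<Omega> m) (PiM I (\<lambda>_. borel)) (compose I (\<lambda>(x, y). x + y))" for m
    unfolding \<Omega>_def by (rule PiM_convolution[OF I(1) real_distribution_gauss R])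
  moreover have "compose I (\<lambda>(x, y). x + y) \<in> \<Omega> (\<lambda>_. 0) \<rightarrow>\<^sub>M PiM I (\<lambda>_. borel)"
    unfolding \<Omega>_def by (intro measurable_compose_PiM measurable_add_real_distribution real_distribution_gauss R)
  ultimately show ?thesis by (simp add: tv_bound_distr)
qed

section \<open>Levy measures and increment laws\<close>

text \<open>Integrated form of h = 1 + (h - 1)^+ - (h - 1)^-. The parts \<alpha> and \<beta> enter
  without compensator, and the compensators left over from \<open>levy_kernel\<close> add up to the
  \<open>gamma_diff\<close> term.\<close>

lemma levy_measure_difference:
  assumes levy: "levy_measure \<nu>1" "levy_measure \<nu>2"
    and ac: "absolutely_continuous \<nu>2 \<nu>1" and L1: "L1_levy \<nu>1 \<nu>2 < \<infinity>"
  obtains \<alpha> \<beta> where "finite_measure \<alpha>" "finite_measure \<beta>" "sets \<alpha> = sets borel" "sets \<beta> = sets borel"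
    "measure \<alpha> (space \<alpha>) + measure \<beta> (space \<beta>) = enn2real (L1_levy \<nu>1 \<nu>2)"
    "\<And>u. (CLINT y|\<nu>1. levy_kernel u y) + (CLINT y|\<beta>. 1 - iexp (u * y)) =
      (CLINT y|\<nu>2. levy_kernel u y) + (CLINT y|\<alpha>. 1 - iexp (u * y)) + \<i> * of_real (u * gamma_diff \<nu>1 \<nu>2)"
proof -
  note sets1[measurable_cong] = sets_levy_measure[OF levy(1)] and sets2[measurable_cong] = sets_levy_measure[OF levy(2)]
  interpret sigma_finite_measure \<nu>2 by (rule sigma_finite_levy_measure[OF levy(2)])
  have [measurable]: "(\<lambda>y. y) \<in> borel_measurable \<nu>2" by (simp add: measurable_cong_sets[OF sets2 refl])
  define h where "h y = enn2real (RN_deriv \<nu>2 \<nu>1 y)" for y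
  have h[measurable]: "h \<in> borel_measurable \<nu>2" unfolding h_def by measurable
  have h0: "0 \<le> h y" for y by (simp add: h_def)
  \<comment> \<open>Almost everywhere finiteness makes \<open>enn2real\<close> harmless, which would
    turn an infinite density into 0.\<close>
  have fin: "AE y in \<nu>2. RN_deriv \<nu>2 \<nu>1 y \<noteq> \<infinity>"
    by (rule RN_deriv_finite[OF sigma_finite_levy_measure[OF levy(1)] ac]) (simp add: sets1 sets2)
  have \<nu>1: "\<nu>1 = density \<nu>2 (\<lambda>y. ennreal (h y))"
  proof -
    have "\<nu>1 = density \<nu>2 (RN_deriv \<nu>2 \<nu>1)"
      by (rule density_RN_deriv[symmetric, OF ac]) (simp add: sets1 sets2)
    also have "\<dots> = density \<nu>2 (\<lambda>y. ennreal (h y))"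
      using fin by (intro density_cong) (auto simp: h_def less_top)
    finally show ?thesis .
  qed
  have int: "integrable \<nu>2 (\<lambda>y. h y - 1)"
    using L1 by (intro integrableI_bounded) (auto simp: L1_levy_def h_def)
  have intp: "integrable \<nu>2 (\<lambda>y. max 0 (h y - 1))" "integrable \<nu>2 (\<lambda>y. max 0 (1 - h y))"
    by (rule Bochner_Integration.integrable_bound[OF int]; auto)+
  define \<alpha> where "\<alpha> = density \<nu>2 (\<lambda>y. ennreal (max 0 (h y - 1)))"
  define \<beta> where "\<beta> = density \<nu>2 (\<lambda>y. ennreal (max 0 (1 - h y)))"
  have em: "emeasure \<alpha> (space \<alpha>) = ennreal (LINT y|\<nu>2. max 0 (h y - 1))"
    "emeasure \<beta> (space \<beta>) = ennreal (LINT y|\<nu>2. max 0 (1 - h y))"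
    unfolding \<alpha>_def \<beta>_def using intp
    by (simp_all add: emeasure_density nn_integral_eq_integral[symmetric] cong: nn_integral_cong_simp)
  have mass: "measure \<alpha> (space \<alpha>) + measure \<beta> (space \<beta>) = enn2real (L1_levy \<nu>1 \<nu>2)"
  proof -
    have "measure \<alpha> (space \<alpha>) + measure \<beta> (space \<beta>) = (LINT y|\<nu>2. max 0 (h y - 1) + max 0 (1 - h y))"
      unfolding measure_def em using intp by (simp add: integral_nonneg_AE)
    also have "\<dots> = (LINT y|\<nu>2. \<bar>h y - 1\<bar>)" by (intro Bochner_Integration.integral_cong) auto
    also have "\<dots> = enn2real (L1_levy \<nu>1 \<nu>2)"
      unfolding L1_levy_def h_def[symmetric] by (rule integral_eq_nn_integral) auto
    finally show ?thesis .
  qed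
  have "(CLINT y|\<nu>1. levy_kernel u y) + (CLINT y|\<beta>. 1 - iexp (u * y)) =
      (CLINT y|\<nu>2. levy_kernel u y) + (CLINT y|\<alpha>. 1 - iexp (u * y)) + \<i> * of_real (u * gamma_diff \<nu>1 \<nu>2)" for u
  proof -
    have b: "norm (1 - iexp (u * y)) \<le> 2" for y
      using norm_triangle_ineq4[of 1 "iexp (u * y)"] by simp
    have i: "integrable \<nu>2 (\<lambda>y. c y *\<^sub>R (1 - iexp (u * y)))" if c: "integrable \<nu>2 c" for c
    proof (rule Bochner_Integration.integrable_bound)
      have [measurable]: "c \<in> borel_measurable \<nu>2" using c by auto
      show "(\<lambda>y. c y *\<^sub>R (1 - iexp (u * y))) \<in> borel_measurable \<nu>2" by measurable
      show "integrable \<nu>2 (\<lambda>y. 2 * c y)" using c by simp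
      show "AE y in \<nu>2. norm (c y *\<^sub>R (1 - iexp (u * y))) \<le> norm (2 * c y)"
        using b by (auto simp: abs_mult intro!: AE_I2 mult_left_mono simp: mult.commute[of 2])
    qed
    \<comment> \<open>On {-1..1} the factor y is bounded by 1, so h - 1 dominates, although y itself
      need not be integrable.\<close>
    have ig: "integrable \<nu>2 (\<lambda>y. indicator {-1..1} y *\<^sub>R (y * (h y - 1)))"
      by (rule Bochner_Integration.integrable_bound[OF int])
        (auto simp: indicator_def abs_mult intro!: AE_I2 mult_left_le_one_le)
    have "integrable \<nu>1 (levy_kernel u)" by (rule integrable_levy_kernel[OF levy(1)])
    then have ih: "integrable \<nu>2 (\<lambda>y. h y *\<^sub>R levy_kernel u y)"
      unfolding \<nu>1 using h0 by (subst (asm) integrable_density) auto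
    have 1: "(CLINT y|\<nu>1. levy_kernel u y) = (CLINT y|\<nu>2. h y *\<^sub>R levy_kernel u y)"
      unfolding \<nu>1 using h0 by (subst integral_density) auto
    have 2: "(CLINT y|\<beta>. 1 - iexp (u * y)) = (CLINT y|\<nu>2. max 0 (1 - h y) *\<^sub>R (1 - iexp (u * y)))"
      unfolding \<beta>_def by (subst integral_density) auto
    have 3: "(CLINT y|\<alpha>. 1 - iexp (u * y)) = (CLINT y|\<nu>2. max 0 (h y - 1) *\<^sub>R (1 - iexp (u * y)))"
      unfolding \<alpha>_def by (subst integral_density) auto
    have 4: "\<i> * of_real (u * gamma_diff \<nu>1 \<nu>2) =
      (CLINT y|\<nu>2. \<i> * of_real (u * (indicator {-1..1} y *\<^sub>R (y * (h y - 1)))))"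
      unfolding gamma_diff_def set_lebesgue_integral_def h_def[symmetric] by (simp del: of_real_mult)
    have "(CLINT y|\<nu>1. levy_kernel u y) + (CLINT y|\<beta>. 1 - iexp (u * y)) =
       (CLINT y|\<nu>2. h y *\<^sub>R levy_kernel u y + max 0 (1 - h y) *\<^sub>R (1 - iexp (u * y)))"
      unfolding 1 2 by (rule Bochner_Integration.integral_add[symmetric, OF ih i[OF intp(2)]])
    \<comment> \<open>Pointwise: the kernel is e + c with e = 1 - iexp (u * y) and c the
      compensator, and (h - 1) e + (1 - h)^+ e = (h - 1)^+ e.\<close>
    also have "\<dots> = (CLINT y|\<nu>2. levy_kernel u y + max 0 (h y - 1) *\<^sub>R (1 - iexp (u * y)) +
        \<i> * of_real (u * (indicator {-1..1} y *\<^sub>R (y * (h y - 1)))))"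
      by (intro Bochner_Integration.integral_cong refl)
        (auto simp: levy_kernel_def scaleR_conv_of_real max_def algebra_simps)
    also have "\<dots> = (CLINT y|\<nu>2. levy_kernel u y) + (CLINT y|\<alpha>. 1 - iexp (u * y)) + \<i> * of_real (u * gamma_diff \<nu>1 \<nu>2)"
      unfolding 3 4
      by (intro Bochner_Integration.integral_add[THEN trans] arg_cong2[where f="(+)"] refl
          Bochner_Integration.integrable_add integrable_mult_right integrable_of_real ig
          integrable_levy_kernel[OF levy(2)] i[OF intp(1)])
    finally show ?thesis .
  qed
  moreover have "finite_measure \<alpha>" "finite_measure \<beta>"
    by (rule finite_measureI; simp add: em)+
  ultimately show ?thesis
    using mass by (intro that[of \<alpha> \<beta>]) (simp_all add: \<alpha>_def \<beta>_def sets2)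
qed

section \<open>Increments of an additive law: independence and characteristic functions\<close>

lemma set_integral_split_Ioc:
  fixes f :: "real \<Rightarrow> real"
  assumes f: "set_integrable lebesgue {0..t} f" and st: "0 \<le> s" "s \<le> t"
  shows "set_integrable lebesgue {s<..t} f"
    "(LINT r:{0..t}|lebesgue. f r) = (LINT r:{0..s}|lebesgue. f r) + (LINT r:{s<..t}|lebesgue. f r)"
proof -
  show i: "set_integrable lebesgue {s<..t} f"
    using st by (intro set_integrable_subset[OF f]) auto
  have i': "set_integrable lebesgue {0..s} f"
    using st by (intro set_integrable_subset[OF f]) auto
  have "{0..t} = {0..s} \<union> {s<..t}" using st by auto
  then show "(LINT r:{0..t}|lebesgue. f r) = (LINT r:{0..s}|lebesgue. f r) + (LINT r:{s<..t}|lebesgue. f r)"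
    by (simp only:) (rule set_integral_Un[OF _ i' i], auto)
qed

definition increment_law :: "(real \<Rightarrow> real) measure \<Rightarrow> real \<Rightarrow> real \<Rightarrow> real measure" where
  "increment_law P s t = distr P borel (\<lambda>\<omega>. \<omega> t - \<omega> s)"

context
  fixes P f s2 \<nu>
  assumes law: "additive_law P f s2 \<nu>"
begin

lemma prob_space_additive_law: "prob_space P"
  using law by (simp add: additive_law_def additive_process_def)

lemma measurable_eval_additive_law: "0 \<le> t \<Longrightarrow> (\<lambda>\<omega>. \<omega> t) \<in> borel_measurable P"
  using law by (simp add: additive_law_def additive_process_def coord_def[abs_def])

lemma AE_additive_law_0: "AE \<omega> in P. \<omega> 0 = 0"
  using law by (simp add: additive_law_def additive_process_def coord_def)

lemma indep_increments:
  assumes "0 \<le> t 0" "\<And>i. i < n \<Longrightarrow> t i < t (Suc i)"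
  shows "prob_space.indep_vars P (\<lambda>_. borel) (\<lambda>i \<omega>. \<omega> (t (Suc i)) - \<omega> (t i)) {..<n}"
  using law assms by (simp add: additive_law_def additive_process_def coord_def)

lemma real_distribution_increment_law:
  assumes "0 \<le> s" "0 \<le> t"
  shows "real_distribution (increment_law P s t)"
proof -
  interpret prob_space P by (rule prob_space_additive_law)
  show ?thesis
    unfolding increment_law_def
    by (rule real_distribution_distr)
      (intro borel_measurable_diff measurable_eval_additive_law assms)
qed

lemma distr_increments:
  assumes "0 \<le> t 0" "\<And>i. t i < t (Suc i)" "0 < n"
  shows "distr P (PiM {..<n} (\<lambda>_. borel)) (\<lambda>\<omega>. \<lambda>i\<in>{..<n}. \<omega> (t (Suc i)) - \<omega> (t i)) =
    PiM {..<n} (\<lambda>i. increment_law P (t i) (t (Suc i)))"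
proof -
  interpret prob_space P by (rule prob_space_additive_law)
  have t: "0 \<le> t i" for i
    using assms by (induction i) (auto intro: order_trans less_imp_le)
  show ?thesis
    unfolding increment_law_def using assms
    by (intro indep_vars_iff_distr_eq_PiM'[THEN iffD1] indep_increments borel_measurable_diff
        measurable_eval_additive_law t) auto
qed

text \<open>Independence of the increments over {0..s} and {s..t} makes the characteristic function
  a quotient of those at times t and s; the divisor is an exponential, hence nonzero.\<close>

lemma char_increment_law:
  assumes st: "0 \<le> s" "s < t"
  shows "char (increment_law P s t) u =
    exp (\<i> * of_real (u * (LINT r:{s<..t}|lebesgue. f r)) - of_real (u\<^sup>2 / 2 * (LINT r:{s<..t}|lebesgue. s2 r))
      - of_real (t - s) * (CLINT y|\<nu>. levy_kernel u y))"
proof -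
  interpret prob_space P by (rule prob_space_additive_law)
  define \<psi> where "\<psi> t = exp (\<i> * of_real (u * (LINT r:{0..t}|lebesgue. f r)) -
    of_real (u\<^sup>2 / 2 * (LINT r:{0..t}|lebesgue. s2 r)) - of_real t * (CLINT y|\<nu>. levy_kernel u y))" for t
  have int: "set_integrable lebesgue {0..t} f" "set_integrable lebesgue {0..t} s2"
    using law st by (auto simp: additive_law_def has_local_characteristics_def)
  have meas: "(\<lambda>\<omega>. \<omega> b - \<omega> a) \<in> borel_measurable P" if "0 \<le> a" "0 \<le> b" for a b
    using that by (intro borel_measurable_diff measurable_eval_additive_law)
  have \<psi>: "char (increment_law P 0 r) u = \<psi> r" if "0 \<le> r" for r
  proof -
    have [measurable]: "(\<lambda>\<omega>. \<omega> r) \<in> borel_measurable P" using that by (rule measurable_eval_additive_law)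
    have [measurable]: "(\<lambda>\<omega>. \<omega> 0) \<in> borel_measurable P" by (rule measurable_eval_additive_law) simp
    have "char (increment_law P 0 r) u = (CLINT \<omega>|P. iexp (u * (\<omega> r - \<omega> 0)))"
      unfolding increment_law_def char_def by (subst integral_distr) auto
    also have "\<dots> = (CLINT \<omega>|P. iexp (u * \<omega> r))"
      using AE_additive_law_0 by (intro integral_cong_AE) auto
    also have "\<dots> = \<psi> r"
      using law that unfolding additive_law_def has_local_characteristics_def coord_def \<psi>_def levy_kernel_def by blast
    finally show ?thesis .
  qed
  have "\<psi> t = \<psi> s * char (increment_law P s t) u"
  \<comment> \<open>Independence is available for strictly increasing times, so s = 0 cannot be an
    inner point of a partition and is treated apart.\<close>
  proof (cases "s = 0")
    case True
    have "char (increment_law P 0 0) u = 1"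
      using prob_space by (simp add: increment_law_def char_return[of 0] distr_const)
    then show ?thesis using True st \<psi>[of t] \<psi>[of 0] by simp
  next
    case False
    \<comment> \<open>The times 0 < s < t; the constant continuation is harmless, since strict
      increase is required only for the first two steps.\<close>
    define q where "q i = (if i = 0 then 0 else if i = Suc 0 then s else t)" for i :: nat
    have "indep_vars (\<lambda>_. borel) (\<lambda>i \<omega>. \<omega> (q (Suc i)) - \<omega> (q i)) {..<2}"
      using False st by (intro indep_increments) (auto simp: q_def less_2_cases_iff)
    from char_distr_sum[OF this, of u]
    have "char (increment_law P 0 t) u = char (increment_law P 0 s) u * char (increment_law P s t) u"
      by (simp add: numeral_2_eq_2 lessThan_Suc q_def increment_law_def mult.commute)
    then show ?thesis using \<psi>[of s] \<psi>[of t] st by simp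
  qed
  then have "char (increment_law P s t) u = \<psi> t / \<psi> s"
    by (simp add: \<psi>_def)
  also have "\<dots> = exp (\<i> * of_real (u * (LINT r:{s<..t}|lebesgue. f r)) - of_real (u\<^sup>2 / 2 * (LINT r:{s<..t}|lebesgue. s2 r))
      - of_real (t - s) * (CLINT y|\<nu>. levy_kernel u y))"
    unfolding \<psi>_def exp_diff[symmetric]
      set_integral_split_Ioc(2)[OF int(1) st(1) less_imp_le[OF st(2)]]
      set_integral_split_Ioc(2)[OF int(2) st(1) less_imp_le[OF st(2)]]
    by (intro arg_cong[where f=exp]) (simp add: algebra_simps)
  finally show ?thesis .
qed

end

section \<open>Comparison of the increments over a partition\<close>

lemma real_distribution_eqI_char:
  assumes "real_distribution \<mu>" "real_distribution \<mu>'" "\<And>u. char \<mu> u = char \<mu>' u"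
  shows "\<mu> = \<mu>'"
  using assms by (intro Levy_uniqueness) auto

text \<open>A zero integral would make \<open>f\<close> vanish almost everywhere on the interval,
  and the interval would be a null set.\<close>

lemma set_integral_pos_Ioc:
  fixes f :: "real \<Rightarrow> real"
  assumes f: "set_integrable lebesgue {s<..t} f" and pos: "\<And>r. r \<in> {s<..t} \<Longrightarrow> 0 < f r" and "s < t"
  shows "0 < (LINT r:{s<..t}|lebesgue. f r)"
proof -
  let ?g = "\<lambda>r. indicator {s<..t} r *\<^sub>R f r"
  have g: "integrable lebesgue ?g" using f by (simp add: set_integrable_def)
  have nn: "0 \<le> ?g r" for r using pos[of r] by (auto simp: indicator_def intro: less_imp_le)
  have "(LINT r|lebesgue. ?g r) \<noteq> 0"
  proof
    assume "(LINT r|lebesgue. ?g r) = 0"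
    then have "AE r in lebesgue. ?g r = 0"
      using integral_nonneg_eq_0_iff_AE[OF g] nn by auto
    then have "AE r in lebesgue. r \<notin> {s<..t}"
    proof eventually_elim
      case (elim r) then show ?case using pos[of r] by (auto simp: indicator_def split: if_splits)
    qed
    then have "{s<..t} \<in> null_sets lebesgue"
      by (subst (asm) AE_iff_null_sets[symmetric]) auto
    then show False using \<open>s < t\<close> by (auto simp: null_sets_def)
  qed
  moreover have "0 \<le> (LINT r|lebesgue. ?g r)" using nn by (rule Bochner_Integration.integral_nonneg)
  ultimately show ?thesis unfolding set_lebesgue_integral_def by linarith
qed

text \<open>Integrates (g - c w)^2 / w \<ge> 0 with the minimising c, the ratio of the integrals of
  \<open>g\<close> and \<open>w\<close>. Where \<open>w\<close> vanishes so does \<open>g\<close>,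
  and division by zero gives 0.\<close>

lemma cauchy_schwarz_weighted:
  fixes g w :: "'a \<Rightarrow> real"
  assumes g: "integrable M g" and w: "integrable M w" and gw: "integrable M (\<lambda>r. (g r)\<^sup>2 / w r)"
    and w0: "\<And>r. 0 \<le> w r" and gz: "\<And>r. w r = 0 \<Longrightarrow> g r = 0" and pos: "0 < (LINT r|M. w r)"
  shows "(LINT r|M. g r)\<^sup>2 / (LINT r|M. w r) \<le> (LINT r|M. (g r)\<^sup>2 / w r)"
proof -
  define c where "c = (LINT r|M. g r) / (LINT r|M. w r)"
  have "0 \<le> (LINT r|M. (g r)\<^sup>2 / w r - 2 * c * g r + c\<^sup>2 * w r)"
  proof (rule Bochner_Integration.integral_nonneg)
    fix r
    have "(g r)\<^sup>2 / w r - 2 * c * g r + c\<^sup>2 * w r = (g r - c * w r)\<^sup>2 / w r"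
      using gz[of r] by (cases "w r = 0") (auto simp: field_simps power2_eq_square)
    then show "0 \<le> (g r)\<^sup>2 / w r - 2 * c * g r + c\<^sup>2 * w r" using w0[of r] by simp
  qed
  also have "\<dots> = (LINT r|M. (g r)\<^sup>2 / w r) - 2 * c * (LINT r|M. g r) + c\<^sup>2 * (LINT r|M. w r)"
    using g w gw by simp
  also have "\<dots> = (LINT r|M. (g r)\<^sup>2 / w r) - (LINT r|M. g r)\<^sup>2 / (LINT r|M. w r)"
    using pos by (simp add: c_def field_simps power2_eq_square)
  finally show ?thesis by simp
qed

lemma sorted_partition_exists:
  fixes J :: "real set"
  assumes J: "finite J" "J \<subseteq> {0..T}" and T: "0 < T"
  obtains t n where "t 0 = 0" "\<And>i. t i < t (Suc i)" "0 < n" "t n = T" "J \<subseteq> t ` {..n}"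
proof -
  define l where "l = sorted_list_of_set (insert 0 (insert T J))"
  have set_l: "set l = insert 0 (insert T J)" unfolding l_def using J by (subst set_sorted_list_of_set) auto
  have strict: "l ! i < l ! j" if "i < j" "j < length l" for i j
    using strict_sorted_list_of_set[of "insert 0 (insert T J)"] that unfolding l_def[symmetric]
    by (rule sorted_wrt_nth_less)
  have bounds: "0 \<le> l ! i \<and> l ! i \<le> T" if "i < length l" for i
    using nth_mem[OF that] J T unfolding set_l by auto
  obtain i0 where i0: "i0 < length l" "l ! i0 = 0" using set_l by (metis in_set_conv_nth insertI1)
  have "0 < length l" using i0(1) by (rule le_less_trans[OF le0])
  then have l0: "l ! 0 = 0" using strict[of 0 i0] i0 bounds[of 0] by (cases "i0 = 0") auto
  obtain n where n: "n < length l" "l ! n = T" using set_l by (metis in_set_conv_nth insertI1 insertI2)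
  have n_last: "length l = Suc n"
    using strict[of n "Suc n"] n bounds[of "Suc n"] by (cases "Suc n < length l") auto
  \<comment> \<open>Beyond index n the sequence continues in unit steps, so that it increases
    strictly at every index and the later lemmas need no bound on i.\<close>
  define t where "t i = (if i \<le> n then l ! i else T + real (i - n))" for i
  show ?thesis
  proof
    show "t 0 = 0" by (simp add: t_def l0)
    show "t i < t (Suc i)" for i
    proof (cases "i < n")
      case True then show ?thesis using strict[of i "Suc i"] n_last by (simp add: t_def)
    next
      case False then show ?thesis using n(2) by (auto simp: t_def)
    qed
    show "0 < n" using T l0 n by (cases n) auto
    show "t n = T" using n by (simp add: t_def)
    have "set l \<subseteq> t ` {..n}"
    proof
      fix x assume "x \<in> set l"
      then obtain i where "i < length l" "l ! i = x" by (auto simp: in_set_conv_nth)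
      then show "x \<in> t ` {..n}" using n_last by (intro image_eqI[of _ _ i]) (auto simp: t_def)
    qed
    then show "J \<subseteq> t ` {..n}" using set_l by auto
  qed
qed

context
  fixes f1 f2 s2 :: "real \<Rightarrow> real" and \<nu>1 \<nu>2 :: "real measure" and P1 P2 :: "(real \<Rightarrow> real) measure"
  assumes ac: "absolutely_continuous \<nu>2 \<nu>1" and L1: "L1_levy \<nu>1 \<nu>2 < \<infinity>"
    and law1: "additive_law P1 f1 s2 \<nu>1" and law2: "additive_law P2 f2 s2 \<nu>2"
begin

lemma drift_integrable:
  assumes "0 \<le> s" "s \<le> t"
  shows "set_integrable lebesgue {s<..t} f1" "set_integrable lebesgue {s<..t} f2" "set_integrable lebesgue {s<..t} s2"
proof -
  have "set_integrable lebesgue {0..t} f1" "set_integrable lebesgue {0..t} f2" "set_integrable lebesgue {0..t} s2"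
    using assms law1 law2 by (simp_all add: additive_law_def has_local_characteristics_def)
  then show "set_integrable lebesgue {s<..t} f1" "set_integrable lebesgue {s<..t} f2" "set_integrable lebesgue {s<..t} s2"
    using assms by (auto intro: set_integral_split_Ioc(1))
qed

lemma drift_difference:
  assumes "0 \<le> s" "s \<le> t"
  shows "set_integrable lebesgue {s<..t} (\<lambda>r. f1 r - f2 r - gamma_diff \<nu>1 \<nu>2)"
    and "(LINT r:{s<..t}|lebesgue. f1 r - f2 r - gamma_diff \<nu>1 \<nu>2) =
    (LINT r:{s<..t}|lebesgue. f1 r) - (LINT r:{s<..t}|lebesgue. f2 r) - (t - s) * gamma_diff \<nu>1 \<nu>2"
proof -
  note i = drift_integrable(1,2)[OF assms]
  have c: "set_integrable lebesgue {s<..t} (\<lambda>r. gamma_diff \<nu>1 \<nu>2)"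
    unfolding set_integrable_def real_scaleR_def using assms
    by (intro integrable_mult_left integrable_real_indicator) auto
  show "set_integrable lebesgue {s<..t} (\<lambda>r. f1 r - f2 r - gamma_diff \<nu>1 \<nu>2)"
    by (intro set_integral_diff i c)
  show "(LINT r:{s<..t}|lebesgue. f1 r - f2 r - gamma_diff \<nu>1 \<nu>2) =
    (LINT r:{s<..t}|lebesgue. f1 r) - (LINT r:{s<..t}|lebesgue. f2 r) - (t - s) * gamma_diff \<nu>1 \<nu>2"
    using assms by (simp add: set_integral_diff i c) (simp add: set_lebesgue_integral_def)
qed

text \<open>The displacement of the second increment that matches the first once the jumps are
  completed. Up to sign, its integrand is the expression squared in
  \<open>xi_squared\<close>.\<close>

definition drift_shift :: "real \<Rightarrow> real \<Rightarrow> real" where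
  "drift_shift s t = (LINT r:{s<..t}|lebesgue. f1 r - f2 r - gamma_diff \<nu>1 \<nu>2)"

text \<open>The exponents agree by \<open>levy_measure_difference\<close> multiplied by t - s; the
  \<open>gamma_diff\<close> term is absorbed into the drift. The numbers a and b are the masses of
  \<alpha> and \<beta>, common to all intervals.\<close>

lemma increment_laws_completed:
  obtains a b where "a + b = enn2real (L1_levy \<nu>1 \<nu>2)"
    "\<And>s t. 0 \<le> s \<Longrightarrow> s < t \<Longrightarrow> \<exists>K1 K2. real_distribution K1 \<and> real_distribution K2 \<and>
      measure K1 (- {0}) \<le> (t - s) * b \<and> measure K2 (- {0}) \<le> (t - s) * a \<and>
      (increment_law P1 s t \<star> K1) = ((increment_law P2 s t \<star> return borel (drift_shift s t)) \<star> K2)"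
proof -
  have levy: "levy_measure \<nu>1" "levy_measure \<nu>2"
    using law1 law2 by (auto simp: additive_law_def has_local_characteristics_def)
  obtain \<alpha> \<beta> where ab: "finite_measure \<alpha>" "finite_measure \<beta>" "sets \<alpha> = sets borel" "sets \<beta> = sets borel"
    "measure \<alpha> (space \<alpha>) + measure \<beta> (space \<beta>) = enn2real (L1_levy \<nu>1 \<nu>2)"
    and eq: "\<And>u. (CLINT y|\<nu>1. levy_kernel u y) + (CLINT y|\<beta>. 1 - iexp (u * y)) =
      (CLINT y|\<nu>2. levy_kernel u y) + (CLINT y|\<alpha>. 1 - iexp (u * y)) + \<i> * of_real (u * gamma_diff \<nu>1 \<nu>2)"
    using levy_measure_difference[OF levy ac L1] by metis
  show ?thesis
  proof (rule that[OF ab(5)])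
    fix s t :: real assume st: "0 \<le> s" "s < t"
    then have \<tau>: "0 \<le> t - s" and t: "0 \<le> t" by auto
    obtain K1 where K1: "real_distribution K1" "measure K1 (- {0}) \<le> (t - s) * measure \<beta> (space \<beta>)"
      "\<And>u. char K1 u = exp (- (of_real (t - s) * (CLINT y|\<beta>. 1 - iexp (u * y))))"
      using compound_poisson_exists[OF ab(2,4) \<tau>] by metis
    obtain K2 where K2: "real_distribution K2" "measure K2 (- {0}) \<le> (t - s) * measure \<alpha> (space \<alpha>)"
      "\<And>u. char K2 u = exp (- (of_real (t - s) * (CLINT y|\<alpha>. 1 - iexp (u * y))))"
      using compound_poisson_exists[OF ab(1,3) \<tau>] by metis
    note rd = real_distribution_increment_law[OF law1 st(1) t] real_distribution_increment_law[OF law2 st(1) t]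
    have "(increment_law P1 s t \<star> K1) = ((increment_law P2 s t \<star> return borel (drift_shift s t)) \<star> K2)"
    proof (rule real_distribution_eqI_char)
      fix u
      define k1 where "k1 = (CLINT y|\<nu>1. levy_kernel u y)"
      define k2 where "k2 = (CLINT y|\<nu>2. levy_kernel u y)"
      define eb where "eb = (CLINT y|\<beta>. 1 - iexp (u * y))"
      define ea where "ea = (CLINT y|\<alpha>. 1 - iexp (u * y))"
      define F1 where "F1 = (LINT r:{s<..t}|lebesgue. f1 r)"
      define F2 where "F2 = (LINT r:{s<..t}|lebesgue. f2 r)"
      define V where "V = u\<^sup>2 / 2 * (LINT r:{s<..t}|lebesgue. s2 r)"
      have shift: "drift_shift s t = F1 - F2 - (t - s) * gamma_diff \<nu>1 \<nu>2"
        unfolding drift_shift_def F1_def F2_def using st by (intro drift_difference) auto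
      have k1: "k1 = k2 + ea - eb + \<i> * of_real (u * gamma_diff \<nu>1 \<nu>2)"
        using eq[of u] unfolding k1_def[symmetric] k2_def[symmetric] ea_def[symmetric] eb_def[symmetric]
        by (simp add: algebra_simps)
      have "char (increment_law P1 s t \<star> K1) u = exp (\<i> * of_real (u * F1) - of_real V - of_real (t - s) * k1 + - (of_real (t - s) * eb))"
        unfolding char_convolution[OF rd(1) K1(1)] char_increment_law[OF law1 st] K1(3)
          k1_def[symmetric] eb_def[symmetric] F1_def[symmetric] V_def[symmetric] exp_add[symmetric] ..
      also have "\<dots> = exp (\<i> * of_real (u * F2) - of_real V - of_real (t - s) * k2 + \<i> * of_real (u * drift_shift s t) + - (of_real (t - s) * ea))"
        unfolding k1 shift by (intro arg_cong[where f=exp]) (simp add: algebra_simps)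
      also have "\<dots> = char ((increment_law P2 s t \<star> return borel (drift_shift s t)) \<star> K2) u"
        unfolding char_convolution[OF real_distribution_convolution[OF rd(2) real_distribution_return] K2(1)]
          char_convolution[OF rd(2) real_distribution_return] char_return char_increment_law[OF law2 st] K2(3)
          k2_def[symmetric] ea_def[symmetric] F2_def[symmetric] V_def[symmetric] exp_add[symmetric] ..
      finally show "char (increment_law P1 s t \<star> K1) u = \<dots>" .
    qed (intro real_distribution_convolution real_distribution_return rd K1 K2)+
    with K1 K2 show "\<exists>K1 K2. real_distribution K1 \<and> real_distribution K2 \<and>
      measure K1 (- {0}) \<le> (t - s) * measure \<beta> (space \<beta>) \<and> measure K2 (- {0}) \<le> (t - s) * measure \<alpha> (space \<alpha>) \<and>
      (increment_law P1 s t \<star> K1) = ((increment_law P2 s t \<star> return borel (drift_shift s t)) \<star> K2)"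
      by blast
  qed
qed

text \<open>Triangle inequality along four product laws: first increments, first increments with
  added jumps (equal to shifted second ones with added jumps), shifted second increments, second
  increments. The costs are t n * b, t n * a and e.\<close>

lemma tv_bound_increments:
  assumes t: "t 0 = 0" "\<And>i. t i < t (Suc i)"
    and shift: "tv_bound e (PiM {..<n} (\<lambda>i. increment_law P2 (t i) (t (Suc i)) \<star> return borel (drift_shift (t i) (t (Suc i)))))
      (PiM {..<n} (\<lambda>i. increment_law P2 (t i) (t (Suc i))))"
  shows "tv_bound (t n * enn2real (L1_levy \<nu>1 \<nu>2) + e)
    (PiM {..<n} (\<lambda>i. increment_law P1 (t i) (t (Suc i)))) (PiM {..<n} (\<lambda>i. increment_law P2 (t i) (t (Suc i))))"
proof -
  have t0: "0 \<le> t i" for i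
    using t by (induction i) (auto intro: order_trans less_imp_le)
  obtain a b where ab: "a + b = enn2real (L1_levy \<nu>1 \<nu>2)" and
    "\<And>s t. 0 \<le> s \<Longrightarrow> s < t \<Longrightarrow> \<exists>K1 K2. real_distribution K1 \<and> real_distribution K2 \<and>
      measure K1 (- {0}) \<le> (t - s) * b \<and> measure K2 (- {0}) \<le> (t - s) * a \<and>
      (increment_law P1 s t \<star> K1) = ((increment_law P2 s t \<star> return borel (drift_shift s t)) \<star> K2)"
    using increment_laws_completed by metis
  from this(2)[OF t0 t(2)] obtain K1 K2 where K: "\<And>i. real_distribution (K1 i)" "\<And>i. real_distribution (K2 i)"
    "\<And>i. measure (K1 i) (- {0}) \<le> (t (Suc i) - t i) * b" "\<And>i. measure (K2 i) (- {0}) \<le> (t (Suc i) - t i) * a"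
    "\<And>i. (increment_law P1 (t i) (t (Suc i)) \<star> K1 i) =
      ((increment_law P2 (t i) (t (Suc i)) \<star> return borel (drift_shift (t i) (t (Suc i)))) \<star> K2 i)"
    by metis
  \<comment> \<open>Jump costs are proportional to interval lengths, so refining the partition
    leaves their sum unchanged.\<close>
  have tele: "(\<Sum>i<n. (t (Suc i) - t i) * c) = t n * c" for c
    by (simp add: sum_distrib_right[symmetric] sum_lessThan_telescope t(1))
  note rd = real_distribution_increment_law[OF law1 t0 t0] real_distribution_increment_law[OF law2 t0 t0]
  have 1: "tv_bound (t n * b) (PiM {..<n} (\<lambda>i. increment_law P1 (t i) (t (Suc i))))
    (PiM {..<n} (\<lambda>i. increment_law P1 (t i) (t (Suc i)) \<star> K1 i))"
    using tv_bound_PiM_convolution[OF _ rd(1) K(1), of "{..<n}"]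
    by (rule tv_bound_mono) (auto simp flip: tele intro!: sum_mono K)
  have 2: "tv_bound (t n * a)
    (PiM {..<n} (\<lambda>i. increment_law P2 (t i) (t (Suc i)) \<star> return borel (drift_shift (t i) (t (Suc i)))))
    (PiM {..<n} (\<lambda>i. increment_law P1 (t i) (t (Suc i)) \<star> K1 i))"
    unfolding K(5)
    using tv_bound_PiM_convolution[OF _ real_distribution_convolution[OF rd(2) real_distribution_return] K(2), of "{..<n}"]
    by (rule tv_bound_mono) (auto simp flip: tele intro!: sum_mono K)
  have "t n * b + t n * a + e = t n * enn2real (L1_levy \<nu>1 \<nu>2) + e"
    by (simp add: ab[symmetric] algebra_simps)
  with tv_bound_trans[OF tv_bound_trans[OF 1 tv_bound_sym[OF 2]] shift] show ?thesis by simp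
qed

text \<open>Positive variance lets a centred Gaussian factor be split off every increment; a
  deterministic shift of the increment then becomes a shift of the Gaussian mean.\<close>

lemma tv_bound_drift_shift:
  assumes t: "t 0 = 0" "\<And>i. t i < t (Suc i)" and n: "0 < n" and s2: "\<And>r. 0 \<le> r \<Longrightarrow> 0 < s2 r"
  defines "\<xi> \<equiv> sqrt (\<Sum>i<n. (drift_shift (t i) (t (Suc i)))\<^sup>2 / (LINT r:{t i<..t (Suc i)}|lebesgue. s2 r))"
  shows "tv_bound (cdf std_normal_distribution (\<xi> / 2) - cdf std_normal_distribution (- \<xi> / 2))
    (PiM {..<n} (\<lambda>i. increment_law P2 (t i) (t (Suc i)) \<star> return borel (drift_shift (t i) (t (Suc i)))))
    (PiM {..<n} (\<lambda>i. increment_law P2 (t i) (t (Suc i))))"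
proof -
  have t0: "0 \<le> t i" for i
    using t by (induction i) (auto intro: order_trans less_imp_le)
  have levy: "levy_measure \<nu>2"
    using law2 by (auto simp: additive_law_def has_local_characteristics_def)
  define v where "v i = (LINT r:{t i<..t (Suc i)}|lebesgue. s2 r)" for i
  define d where "d i = drift_shift (t i) (t (Suc i))" for i
  define \<mu> where "\<mu> i = increment_law P2 (t i) (t (Suc i))" for i
  have v: "0 < v i" for i
    unfolding v_def using t(2)[of i] t0[of i]
    by (intro set_integral_pos_Ioc drift_integrable s2) (auto intro: less_imp_le)
  have rd: "real_distribution (\<mu> i)" for i
    unfolding \<mu>_def by (intro real_distribution_increment_law[OF law2] t0)
  have "\<exists>R. real_distribution R \<and> \<mu> i = (gauss 0 (v i) \<star> R)" for i
  proof -
    have "char (\<mu> i) u = char (gauss 0 (v i)) u * exp (\<i> * of_real (u * (LINT r:{t i<..t (Suc i)}|lebesgue. f2 r)) -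
        of_real (t (Suc i) - t i) * (CLINT y|\<nu>2. levy_kernel u y))" for u
      unfolding \<mu>_def char_increment_law[OF law2 t0 t(2)] char_gauss[OF less_imp_le[OF v]] v_def[symmetric]
      by (simp add: exp_add[symmetric] algebra_simps)
    from infinitely_divisible_factor_exists[OF levy rd real_distribution_gauss _ this] t(2)[of i]
    show ?thesis by (metis diff_ge_0_iff_ge less_imp_le)
  qed
  then obtain R where R: "\<And>i. real_distribution (R i)" "\<And>i. \<mu> i = (gauss 0 (v i) \<star> R i)" by metis
  have shifted: "(\<mu> i \<star> return borel (d i)) = (gauss (d i) (v i) \<star> R i)" for i
  proof (rule real_distribution_eqI_char)
    show "char (\<mu> i \<star> return borel (d i)) u = char (gauss (d i) (v i) \<star> R i) u" for u
      unfolding char_convolution[OF rd real_distribution_return] char_return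
      unfolding R(2) char_convolution[OF real_distribution_gauss R(1)] char_gauss[OF less_imp_le[OF v]] by simp
  qed (intro real_distribution_convolution real_distribution_return rd real_distribution_gauss R)+
  show ?thesis
    unfolding \<mu>_def[symmetric] d_def[symmetric] shifted \<xi>_def v_def[symmetric]
    unfolding R(2)[THEN ext]
    by (rule tv_bound_sym[OF tv_bound_PiM_gauss_shift[where R=R and v=v and d=d, OF _ _ v R(1)]]) (use n in auto)
qed

text \<open>Cauchy-Schwarz with weight \<open>s2\<close> on each interval bounds its term by the
  integral of g^2 / s2 there, and the disjoint intervals together stay within {0..t n}.\<close>

lemma sum_drift_shift_le_xi_squared:
  assumes t: "t 0 = 0" "\<And>i. t i < t (Suc i)" and s2: "\<And>r. 0 \<le> r \<Longrightarrow> 0 < s2 r"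
    and \<xi>: "xi_squared (t n) f1 f2 s2 \<nu>1 \<nu>2 = ennreal (x\<^sup>2)"
  shows "(\<Sum>i<n. (drift_shift (t i) (t (Suc i)))\<^sup>2 / (LINT r:{t i<..t (Suc i)}|lebesgue. s2 r)) \<le> x\<^sup>2"
proof -
  have t0: "0 \<le> t i" for i
    using t by (induction i) (auto intro: order_trans less_imp_le)
  have mono: "t i \<le> t j" if "i \<le> j" for i j
    using that by (rule lift_Suc_mono_le[rotated]) (intro less_imp_le t(2))
  define g where "g r = f1 r - f2 r - gamma_diff \<nu>1 \<nu>2" for r
  \<comment> \<open>The point 0 is omitted because the partition intervals are left-open; compared
    with \<open>xi_squared\<close> this can only lower the integral.\<close>
  define Q where "Q r = indicator {0<..t n} r * ((g r)\<^sup>2 / s2 r)" for r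
  have sg: "set_integrable lebesgue {s<..t} g" if "0 \<le> s" "s \<le> t" for s t
    unfolding g_def using that by (rule drift_difference(1))
  have nn: "0 \<le> Q r" for r using s2[of r] by (auto simp: Q_def indicator_def intro: less_imp_le)
  have Qm: "Q \<in> borel_measurable lebesgue"
  proof -
    have [measurable]: "(\<lambda>r. indicator {0<..t n} r *\<^sub>R g r) \<in> borel_measurable lebesgue"
      "(\<lambda>r. indicator {0<..t n} r *\<^sub>R s2 r) \<in> borel_measurable lebesgue"
      using sg[of 0 "t n"] drift_integrable(3)[of 0 "t n"] t0 by (auto simp: set_integrable_def)
    \<comment> \<open>Measurability of \<open>g\<close> and \<open>s2\<close> is known after
      restriction to the interval; outside it the restricted quotient is 0 / 0 = 0.\<close>
    have "Q = (\<lambda>r. (indicator {0<..t n} r *\<^sub>R g r)\<^sup>2 / (indicator {0<..t n} r *\<^sub>R s2 r))"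
      by (auto simp: Q_def fun_eq_iff indicator_def)
    then show ?thesis by (simp only:) measurable
  qed
  have le: "(\<integral>\<^sup>+r. ennreal (Q r) \<partial>lebesgue) \<le> ennreal (x\<^sup>2)"
  proof -
    have "(f2 r - f1 r - (- gamma_diff \<nu>1 \<nu>2))\<^sup>2 = (g r)\<^sup>2" for r
      by (simp add: g_def power2_eq_square algebra_simps)
    then show ?thesis
      unfolding \<xi>[symmetric] xi_squared_def by (intro nn_integral_mono) (auto simp: Q_def indicator_def)
  qed
  have Qi: "integrable lebesgue Q"
    using le nn Qm by (intro integrableI_nonneg) (auto simp: order_le_less_trans[OF le])
  have intQ: "(LINT r|lebesgue. Q r) \<le> x\<^sup>2"
    using nn_integral_eq_integral[OF Qi] nn le by simp
  have sQ: "set_integrable lebesgue A Q" if "A \<in> sets lebesgue" for A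
    unfolding set_integrable_def using that Qi by (intro integrable_mult_indicator)
  have "(drift_shift (t i) (t (Suc i)))\<^sup>2 / (LINT r:{t i<..t (Suc i)}|lebesgue. s2 r) \<le> (LINT r:{t i<..t (Suc i)}|lebesgue. Q r)"
    if "i < n" for i
  proof -
    let ?I = "{t i<..t (Suc i)}"
    have sub: "r \<in> {0<..t n}" if "r \<in> ?I" for r
      using that t0[of i] mono[of "Suc i" n] \<open>i < n\<close> by auto
    have eq: "(\<lambda>r. (indicator ?I r *\<^sub>R g r)\<^sup>2 / (indicator ?I r *\<^sub>R s2 r)) = (\<lambda>r. indicator ?I r *\<^sub>R Q r)"
      using sub by (auto simp: Q_def fun_eq_iff indicator_def)
    have "(LINT r|lebesgue. indicator ?I r *\<^sub>R g r)\<^sup>2 / (LINT r|lebesgue. indicator ?I r *\<^sub>R s2 r) \<le>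
      (LINT r|lebesgue. (indicator ?I r *\<^sub>R g r)\<^sup>2 / (indicator ?I r *\<^sub>R s2 r))"
    proof (rule cauchy_schwarz_weighted)
      show "integrable lebesgue (\<lambda>r. indicator ?I r *\<^sub>R g r)" "integrable lebesgue (\<lambda>r. indicator ?I r *\<^sub>R s2 r)"
        using sg drift_integrable(3) t0 less_imp_le[OF t(2)] unfolding set_integrable_def by auto
      show "integrable lebesgue (\<lambda>r. (indicator ?I r *\<^sub>R g r)\<^sup>2 / (indicator ?I r *\<^sub>R s2 r))"
        unfolding eq using sQ[of ?I] by (simp add: set_integrable_def)
      show "0 \<le> indicator ?I r *\<^sub>R s2 r" "indicator ?I r *\<^sub>R s2 r = 0 \<Longrightarrow> indicator ?I r *\<^sub>R g r = 0" for r
        using s2[of r] t0[of i] by (auto simp: indicator_def split: if_splits)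
      show "0 < (LINT r|lebesgue. indicator ?I r *\<^sub>R s2 r)"
        unfolding set_lebesgue_integral_def[symmetric] using t0[of i] t(2)[of i]
        by (intro set_integral_pos_Ioc drift_integrable s2) (auto intro: less_imp_le)
    qed
    then show ?thesis
      unfolding eq by (simp add: drift_shift_def set_lebesgue_integral_def g_def)
  qed
  then have "(\<Sum>i<n. (drift_shift (t i) (t (Suc i)))\<^sup>2 / (LINT r:{t i<..t (Suc i)}|lebesgue. s2 r)) \<le>
    (\<Sum>i<n. LINT r:{t i<..t (Suc i)}|lebesgue. Q r)"
    by (intro sum_mono) auto
  also have "(\<Sum>i<m. LINT r:{t i<..t (Suc i)}|lebesgue. Q r) = (LINT r:{0<..t m}|lebesgue. Q r)" for m
  proof (induction m)
    case 0
    show ?case by (simp add: t(1) set_lebesgue_integral_def)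
  next
    case (Suc m)
    have "{0<..t (Suc m)} = {0<..t m} \<union> {t m<..t (Suc m)}"
      using t0[of m] t(2)[of m] by auto
    then show ?case
      by (simp only:) (subst set_integral_Un, auto simp: Suc intro!: sQ)
  qed
  also have "(LINT r:{0<..t n}|lebesgue. Q r) = (LINT r|lebesgue. Q r)"
    unfolding set_lebesgue_integral_def by (intro Bochner_Integration.integral_cong) (auto simp: Q_def indicator_def)
  also note intQ
  finally show ?thesis .
qed

end

section \<open>Passage to path space\<close>

lemma coord_algebra_mono: "I \<subseteq> J \<Longrightarrow> sets (coord_algebra I) \<subseteq> sets (coord_algebra J)"
  unfolding sets_coord_algebra by (rule sigma_sets_mono') auto

lemma measure_Union_approx:
  assumes "finite_measure M" and A: "\<And>i::nat. A i \<in> sets M" and "0 < e"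
  shows "\<forall>\<^sub>F n in sequentially. measure M ((\<Union>i. A i) - (\<Union>i<n. A i)) < e"
proof -
  interpret finite_measure M by fact
  have "incseq (\<lambda>n. \<Union>i<n. A i)"
    unfolding incseq_def by (intro allI impI UN_mono) auto
  then have "(\<lambda>n. measure M (\<Union>i<n. A i)) \<longlonglongrightarrow> measure M (\<Union>n. \<Union>i<n. A i)"
    using A by (intro finite_Lim_measure_incseq) auto
  moreover have "(\<Union>n. \<Union>i<n. A i) = (\<Union>i. A i)" by auto
  ultimately have "(\<lambda>n. measure M (\<Union>i. A i) - measure M (\<Union>i<n. A i)) \<longlonglongrightarrow> 0"
    using tendsto_diff[OF tendsto_const, of _ "measure M (\<Union>i. A i)" sequentially "measure M (\<Union>i. A i)"] by simp
  then have "\<forall>\<^sub>F n in sequentially. measure M (\<Union>i. A i) - measure M (\<Union>i<n. A i) < e"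
    using \<open>0 < e\<close> by (rule order_tendstoD(2))
  then show ?thesis
  proof eventually_elim
    case (elim n)
    then show ?case
      using A by (subst finite_measure_Diff) auto
  qed
qed

text \<open>Total variation bounds do not pass through a \<open>\<pi>\<close>-\<open>\<lambda>\<close> argument; instead events are approximated
  in measure, simultaneously under finitely many laws, by events depending on finitely many times.\<close>

lemma coord_algebra_approx:
  assumes fin: "finite \<P>" and P: "\<And>P. P \<in> \<P> \<Longrightarrow> finite_measure P"
    and sub: "\<And>P. P \<in> \<P> \<Longrightarrow> sets (coord_algebra I) \<subseteq> sets P"
    and A: "A \<in> sets (coord_algebra I)" and "0 < e"
  shows "\<exists>J B. finite J \<and> J \<subseteq> I \<and> B \<in> sets (coord_algebra J) \<and>
    (\<forall>P\<in>\<P>. measure P ((A - B) \<union> (B - A)) < e)"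
proof -
  have "A \<in> sigma_sets skorokhod_space {coord s -` A \<inter> skorokhod_space | s A. s \<in> I \<and> A \<in> sets borel}"
    using A by (simp add: sets_coord_algebra)
  then show ?thesis
    using \<open>0 < e\<close>
  proof (induction arbitrary: e rule: sigma_sets.induct)
    case (Basic a)
    then obtain s S where s: "s \<in> I" "S \<in> sets borel" "a = coord s -` S \<inter> skorokhod_space" by auto
    then have "a \<in> sets (coord_algebra {s})"
      unfolding sets_coord_algebra by (intro sigma_sets.Basic) auto
    with s Basic.prems show ?case by (intro exI[of _ "{s}"] exI[of _ a]) auto
  next
    case Empty
    then show ?case by (intro exI[of _ "{}"]) auto
  next
    case (Compl a)
    obtain J B where B: "finite J" "J \<subseteq> I" "B \<in> sets (coord_algebra J)"
      "\<forall>P\<in>\<P>. measure P ((a - B) \<union> (B - a)) < e"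
      using Compl.IH[OF Compl.prems] by auto
    have "a \<subseteq> skorokhod_space"
      using Compl.hyps by (rule sigma_sets_into_sp[rotated]) auto
    moreover have "B \<subseteq> skorokhod_space" using sets.sets_into_space[OF B(3)] by simp
    ultimately have "(skorokhod_space - a - (skorokhod_space - B)) \<union> (skorokhod_space - B - (skorokhod_space - a)) = (a - B) \<union> (B - a)"
      by auto
    moreover have "skorokhod_space - B \<in> sets (coord_algebra J)"
      using sets.compl_sets[OF B(3)] by simp
    ultimately show ?case
      using B by (intro exI[of _ J] exI[of _ "skorokhod_space - B"]) simp
  next
    case (Union a)
    have a: "a i \<in> sets (coord_algebra I)" for i using Union.hyps by (simp add: sets_coord_algebra)
    \<comment> \<open>Finiteness of the family of laws gives one cut-off n valid for all of
      them.\<close>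
    have "\<forall>\<^sub>F n in sequentially. \<forall>P\<in>\<P>. measure P ((\<Union>i. a i) - (\<Union>i<n. a i)) < e / 2"
      using Union.prems a sub by (intro eventually_ball_finite fin ballI measure_Union_approx P) auto
    then obtain n where n: "\<forall>P\<in>\<P>. measure P ((\<Union>i. a i) - (\<Union>i<n. a i)) < e / 2"
      by (auto simp: eventually_sequentially)
    \<comment> \<open>The n approximation errors then total at most e / 2, the tail being strictly
      below e / 2; the added 1 covers n = 0.\<close>
    define d where "d = e / (2 * (real n + 1))"
    have d: "0 < d" using Union.prems by (simp add: d_def)
    obtain J B where B: "\<And>i. finite (J i)" "\<And>i. J i \<subseteq> I" "\<And>i. B i \<in> sets (coord_algebra (J i))"
      "\<And>i P. P \<in> \<P> \<Longrightarrow> measure P ((a i - B i) \<union> (B i - a i)) < d"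
      using Union.IH[OF d] by metis
    have BI: "B i \<in> sets (coord_algebra I)" for i using B(3) coord_algebra_mono[OF B(2)] by auto
    show ?case
    proof (intro exI[of _ "\<Union>i<n. J i"] exI[of _ "\<Union>i<n. B i"] conjI ballI)
      show "finite (\<Union>i<n. J i)" "(\<Union>i<n. J i) \<subseteq> I" using B by auto
      have "B i \<in> sets (coord_algebra (\<Union>i<n. J i))" if "i < n" for i
        using B(3)[of i] coord_algebra_mono[of "J i" "\<Union>i<n. J i"] that by auto
      then show "(\<Union>i<n. B i) \<in> sets (coord_algebra (\<Union>i<n. J i))" by auto
      fix P assume PP: "P \<in> \<P>"
      interpret finite_measure P by (rule P[OF PP])
      have sets: "a i \<in> sets P" "B i \<in> sets P" for i using a BI sub[OF PP] by auto
      let ?U = "(\<Union>i. a i) - (\<Union>i<n. a i)" and ?D = "\<Union>i<n. (a i - B i) \<union> (B i - a i)"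
      have "measure P (((\<Union>i. a i) - (\<Union>i<n. B i)) \<union> ((\<Union>i<n. B i) - (\<Union>i. a i))) \<le> measure P (?U \<union> ?D)"
        using sets by (intro finite_measure_mono) auto
      also have "\<dots> \<le> measure P ?U + measure P ?D"
        using sets by (intro measure_Un_le) auto
      also have "measure P ?D \<le> (\<Sum>i<n. measure P ((a i - B i) \<union> (B i - a i)))"
        using sets by (intro measure_UNION_le) auto
      also have "\<dots> \<le> (\<Sum>i<n. d)"
        using B(4)[OF PP] by (intro sum_mono) (auto intro: less_imp_le)
      also have "(\<Sum>i<n. d) \<le> e / 2"
        using Union.prems by (simp add: d_def field_simps)
      also have "measure P ?U < e / 2" using n PP by auto
      finally show "measure P (((\<Union>i. a i) - (\<Union>i<n. B i)) \<union> ((\<Union>i<n. B i) - (\<Union>i. a i))) < e" by simp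
    qed
  qed
qed

text \<open>For a path starting at 0, values at partition points are partial sums of increments, so
  the generating events are events of the increments; complements and countable unions preserve
  this.\<close>

lemma coord_algebra_increments:
  fixes t :: "nat \<Rightarrow> real"
  assumes B: "B \<in> sets (coord_algebra J)" and J: "J \<subseteq> t ` {..n}" and t0: "t 0 = 0"
  shows "\<exists>C\<in>sets (PiM {..<n} (\<lambda>_. borel :: real measure)). \<forall>\<omega>\<in>skorokhod_space. \<omega> 0 = 0 \<longrightarrow>
    (\<omega> \<in> B \<longleftrightarrow> (\<lambda>i\<in>{..<n}. \<omega> (t (Suc i)) - \<omega> (t i)) \<in> C)"
proof -
  let ?M = "PiM {..<n} (\<lambda>_. borel :: real measure)"
  have sp: "(\<lambda>i\<in>{..<n}. \<omega> (t (Suc i)) - \<omega> (t i)) \<in> space ?M" for \<omega> :: "real \<Rightarrow> real"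
    by (simp add: space_PiM)
  have "B \<in> sigma_sets skorokhod_space {coord s -` A \<inter> skorokhod_space | s A. s \<in> J \<and> A \<in> sets borel}"
    using B by (simp add: sets_coord_algebra)
  then show ?thesis
  proof (induction rule: sigma_sets.induct)
    case (Basic a)
    then obtain s S where s: "s \<in> J" "S \<in> sets borel" "a = coord s -` S \<inter> skorokhod_space" by auto
    then obtain k where k: "k \<le> n" "s = t k" using J by auto
    have tele: "(\<Sum>i<k. (\<lambda>i\<in>{..<n}. \<omega> (t (Suc i)) - \<omega> (t i)) i) = \<omega> (t k) - \<omega> (t 0)" for \<omega> :: "real \<Rightarrow> real"
      using k(1) sum_lessThan_telescope[of "\<lambda>i. \<omega> (t i)" k] by simp
    have "(\<lambda>x. \<Sum>i<k. x i) \<in> borel_measurable ?M"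
      using k(1) by (intro borel_measurable_sum measurable_component_singleton) auto
    from measurable_sets[OF this s(2)] show ?case
    proof (rule bexI[rotated], intro ballI impI)
      fix \<omega> :: "real \<Rightarrow> real" assume "\<omega> \<in> skorokhod_space" "\<omega> 0 = 0"
      then show "\<omega> \<in> a \<longleftrightarrow> (\<lambda>i\<in>{..<n}. \<omega> (t (Suc i)) - \<omega> (t i)) \<in> (\<lambda>x. \<Sum>i<k. x i) -` S \<inter> space ?M"
        using sp[of \<omega>] tele[of \<omega>] by (simp add: s(3) k(2) coord_def t0 del: restrict_apply)
    qed
  next
    case Empty
    show ?case by (rule bexI[of _ "{}"]) auto
  next
    case (Compl a)
    then obtain C where C: "C \<in> sets ?M" "\<forall>\<omega>\<in>skorokhod_space. \<omega> 0 = 0 \<longrightarrow>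
      (\<omega> \<in> a \<longleftrightarrow> (\<lambda>i\<in>{..<n}. \<omega> (t (Suc i)) - \<omega> (t i)) \<in> C)" by (elim bexE)
    then show ?case
      using sp by (intro bexI[of _ "space ?M - C"] ballI impI) (simp_all only: Diff_iff sets.compl_sets simp_thms)
  next
    case (Union a)
    from Union.IH have "\<forall>i. \<exists>C. C \<in> sets ?M \<and> (\<forall>\<omega>\<in>skorokhod_space. \<omega> 0 = 0 \<longrightarrow>
      (\<omega> \<in> a i \<longleftrightarrow> (\<lambda>i\<in>{..<n}. \<omega> (t (Suc i)) - \<omega> (t i)) \<in> C))"
      by (intro allI) (simp only: Bex_def)
    from choice[OF this] obtain C where C: "\<forall>i. C i \<in> sets ?M \<and> (\<forall>\<omega>\<in>skorokhod_space. \<omega> 0 = 0 \<longrightarrow>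
      (\<omega> \<in> a i \<longleftrightarrow> (\<lambda>i\<in>{..<n}. \<omega> (t (Suc i)) - \<omega> (t i)) \<in> C i))" ..
    show ?case
    proof (rule bexI[of _ "\<Union>i. C i"])
      show "(\<Union>i. C i) \<in> sets ?M" using C by (intro sets.countable_UN) auto
      show "\<forall>\<omega>\<in>skorokhod_space. \<omega> 0 = 0 \<longrightarrow>
        (\<omega> \<in> (\<Union>i. a i) \<longleftrightarrow> (\<lambda>i\<in>{..<n}. \<omega> (t (Suc i)) - \<omega> (t i)) \<in> (\<Union>i. C i))"
        using C by (simp only: UN_iff) blast
    qed
  qed
qed

text \<open>\<open>B\<close> and the preimage of \<open>C\<close> may differ on paths not starting
  at 0, but these form a null set.\<close>

lemma measure_cylinder_eq_increments:
  assumes law: "additive_law P f s2 \<nu>" and t: "t 0 = 0" "\<And>i. t i < t (Suc i)" "0 < n"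
    and B: "B \<in> sets P" and C: "C \<in> sets (PiM {..<n} (\<lambda>_. borel :: real measure))"
    and BC: "\<And>\<omega>. \<omega> \<in> skorokhod_space \<Longrightarrow> \<omega> 0 = 0 \<Longrightarrow>
      \<omega> \<in> B \<longleftrightarrow> (\<lambda>i\<in>{..<n}. \<omega> (t (Suc i)) - \<omega> (t i)) \<in> C"
  shows "measure P B = measure (PiM {..<n} (\<lambda>i. increment_law P (t i) (t (Suc i)))) C"
proof -
  have t0: "0 \<le> t i" for i
    using t by (induction i) (auto intro: order_trans less_imp_le)
  have sp: "space P = skorokhod_space"
    using law sets_eq_imp_space_eq[of P skorokhod_algebra] by (simp add: additive_law_def)
  let ?\<Delta> = "\<lambda>\<omega>. \<lambda>i\<in>{..<n}. \<omega> (t (Suc i)) - \<omega> (t i)"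
  have \<Delta>: "?\<Delta> \<in> P \<rightarrow>\<^sub>M PiM {..<n} (\<lambda>_. borel)"
    by (intro measurable_restrict borel_measurable_diff measurable_eval_additive_law[OF law] t0)
  have "measure P B = measure P (?\<Delta> -` C \<inter> space P)"
    unfolding measure_def
    by (rule arg_cong[where f=enn2real], rule emeasure_eq_AE[OF _ B measurable_sets[OF \<Delta> C]])
      (use AE_additive_law_0[OF law] AE_space in \<open>eventually_elim, auto simp: sp BC\<close>)
  also have "\<dots> = measure (distr P (PiM {..<n} (\<lambda>_. borel)) ?\<Delta>) C"
    using \<Delta> C by (simp add: measure_distr)
  also have "\<dots> = measure (PiM {..<n} (\<lambda>i. increment_law P (t i) (t (Suc i)))) C"
    using t by (subst distr_increments[OF law]) auto
  finally show ?thesis .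
qed

text \<open>An event up to time T is within e / 2, under both laws, of an event on finitely many
  times, which is read off from increments. As \<open>c\<close> does not depend on the partition, e
  may tend to 0.\<close>

lemma L1_prob_law_upto_le:
  assumes law1: "additive_law P1 f1 s1 \<nu>1" and law2: "additive_law P2 f2 s2 \<nu>2" and T: "0 < T"
    and tv: "\<And>t n. t 0 = 0 \<Longrightarrow> (\<And>i. t i < t (Suc i)) \<Longrightarrow> 0 < n \<Longrightarrow> t n = T \<Longrightarrow>
      tv_bound c (PiM {..<n} (\<lambda>i. increment_law P1 (t i) (t (Suc i)))) (PiM {..<n} (\<lambda>i. increment_law P2 (t i) (t (Suc i))))"
  shows "L1_prob (law_upto T P1) (law_upto T P2) \<le> 2 * c"
proof -
  interpret P1: prob_space P1 by (rule prob_space_additive_law[OF law1])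
  interpret P2: prob_space P2 by (rule prob_space_additive_law[OF law2])
  have sets: "sets P1 = sets skorokhod_algebra" "sets P2 = sets skorokhod_algebra"
    using law1 law2 by (auto simp: additive_law_def)
  note sub1 = subalgebra_coord_algebra[OF sets(1), of T] and sub2 = subalgebra_coord_algebra[OF sets(2), of T]
  have incl: "sets (skorokhod_algebra_upto T) \<subseteq> sets P1" "sets (skorokhod_algebra_upto T) \<subseteq> sets P2"
    using sub1 sub2 by (auto simp: subalgebra_def)
  have le: "\<bar>measure P1 A - measure P2 A\<bar> \<le> c" if A: "A \<in> sets (skorokhod_algebra_upto T)" for A
  proof (rule field_le_epsilon)
    fix e :: real assume "0 < e"
    have "\<exists>J B. finite J \<and> J \<subseteq> {0..T} \<and> B \<in> sets (coord_algebra J) \<and>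
      (\<forall>P\<in>{P1, P2}. measure P ((A - B) \<union> (B - A)) < e / 2)"
      using \<open>0 < e\<close> A incl P1.finite_measure_axioms P2.finite_measure_axioms by (intro coord_algebra_approx) auto
    then obtain J B where B: "finite J" "J \<subseteq> {0..T}" "B \<in> sets (coord_algebra J)"
      "measure P1 ((A - B) \<union> (B - A)) < e / 2" "measure P2 ((A - B) \<union> (B - A)) < e / 2" by auto
    have BP: "B \<in> sets P1" "B \<in> sets P2" "A \<in> sets P1" "A \<in> sets P2"
      using B(3) coord_algebra_mono[OF B(2)] incl A by auto
    obtain t n where t: "t 0 = 0" "\<And>i. t i < t (Suc i)" "0 < n" "t n = T" "J \<subseteq> t ` {..n}"
      using sorted_partition_exists[OF B(1,2) T] by metis
    obtain C where C: "C \<in> sets (PiM {..<n} (\<lambda>_. borel :: real measure))"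
      "\<And>\<omega>. \<omega> \<in> skorokhod_space \<Longrightarrow> \<omega> 0 = 0 \<Longrightarrow> \<omega> \<in> B \<longleftrightarrow> (\<lambda>i\<in>{..<n}. \<omega> (t (Suc i)) - \<omega> (t i)) \<in> C"
      using coord_algebra_increments[OF B(3) t(5,1)] by auto
    have "sets (PiM {..<n} (\<lambda>i. increment_law P1 (t i) (t (Suc i)))) = sets (PiM {..<n} (\<lambda>_. borel :: real measure))"
      by (intro sets_PiM_cong) (auto simp: increment_law_def)
    then have "\<bar>measure (PiM {..<n} (\<lambda>i. increment_law P1 (t i) (t (Suc i)))) C
        - measure (PiM {..<n} (\<lambda>i. increment_law P2 (t i) (t (Suc i)))) C\<bar> \<le> c"
      using tv[OF t(1-4)] C(1) unfolding tv_bound_def by metis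
    then have "\<bar>measure P1 B - measure P2 B\<bar> \<le> c"
      by (simp only: measure_cylinder_eq_increments[OF law1 t(1-3) BP(1) C]
          measure_cylinder_eq_increments[OF law2 t(1-3) BP(2) C])
    moreover have "\<bar>measure P A - measure P B\<bar> \<le> measure P ((A - B) \<union> (B - A))"
      if "prob_space P" "A \<in> sets P" "B \<in> sets P" for P
    proof -
      interpret prob_space P by fact
      have "measure P A \<le> measure P B + measure P ((A - B) \<union> (B - A))"
        using that by (intro order_trans[OF finite_measure_mono measure_Un_le]) auto
      moreover have "measure P B \<le> measure P A + measure P ((A - B) \<union> (B - A))"
        using that by (intro order_trans[OF finite_measure_mono measure_Un_le]) auto
      ultimately show ?thesis by linarith
    qed
    note this[OF P1.prob_space_axioms BP(3,1)] this[OF P2.prob_space_axioms BP(4,2)]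
    ultimately show "\<bar>measure P1 A - measure P2 A\<bar> \<le> c + e" using B(4,5) by linarith
  qed
  have "(SUP A\<in>sets (law_upto T P1). \<bar>measure (law_upto T P1) A - measure (law_upto T P2) A\<bar>) \<le> c"
  proof (rule cSUP_least)
    fix A assume "A \<in> sets (law_upto T P1)"
    then have A: "A \<in> sets (skorokhod_algebra_upto T)"
      by (simp add: law_upto_def sets_restr_to_subalg[OF sub1])
    then show "\<bar>measure (law_upto T P1) A - measure (law_upto T P2) A\<bar> \<le> c"
      using le[OF A] by (simp add: law_upto_def measure_def emeasure_restr_to_subalg[OF sub1] emeasure_restr_to_subalg[OF sub2])
  qed auto
  then show ?thesis by (simp add: L1_prob_def)
qed

text \<open>The characteristic function is even, so the law is invariant under reflection; the
  absence of atoms then allows the endpoint - x to be included.\<close>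

lemma cdf_std_normal_symmetric: "cdf std_normal_distribution x = 1 - cdf std_normal_distribution (- x)"
proof -
  interpret real_distribution std_normal_distribution by (rule real_dist_normal_dist)
  have sym: "std_normal_distribution = distr std_normal_distribution borel (\<lambda>x. 0 + (- 1) * x)"
  proof (rule real_distribution_eqI_char[OF real_dist_normal_dist real_distribution_distr_std_normal])
    show "char std_normal_distribution u = char (distr std_normal_distribution borel (\<lambda>x. 0 + (- 1) * x)) u" for u
      unfolding char_affine_std_normal char_std_normal_distribution by (simp flip: exp_of_real)
  qed measurable
  have "cdf std_normal_distribution x = measure std_normal_distribution {- x..}"
    unfolding cdf_def
    by (subst sym, subst measure_distr) (auto intro!: arg_cong[where f="measure std_normal_distribution"])
  also have "\<dots> = 1 - measure std_normal_distribution {..<- x}"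
    using prob_compl[of "{..<- x}"] by (simp add: Compl_eq_Diff_UNIV[symmetric] Compl_lessThan)
  also have "measure std_normal_distribution {..<- x} = cdf std_normal_distribution (- x)"
  proof -
    have "emeasure std_normal_distribution {- x} = 0"
      by (subst emeasure_density) (auto simp: nn_integral_indicator_singleton')
    then have "measure std_normal_distribution {- x} = 0" by (simp add: measure_def)
    moreover have "measure std_normal_distribution {..- x} = measure std_normal_distribution {..<- x} + measure std_normal_distribution {- x}"
      by (subst finite_measure_Union[symmetric]) (auto intro!: arg_cong[where f="measure std_normal_distribution"])
    ultimately show ?thesis by (simp add: cdf_def)
  qed
  finally show ?thesis .
qed

text \<open>The difference sinh z - z is 0 at 0 and has derivative cosh z - 1 \<ge> 0.\<close>

lemma le_sinh_real: "0 \<le> x \<Longrightarrow> x \<le> sinh (x :: real)"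
proof -
  assume "0 \<le> x"
  have "sinh 0 - 0 \<le> sinh x - x"
    using \<open>0 \<le> x\<close>
  proof (rule DERIV_nonneg_imp_nondecreasing)
    show "\<exists>y. ((\<lambda>x. sinh x - x) has_real_derivative y) (at z) \<and> 0 \<le> y" for z :: real
      using cosh_real_ge_1[of z] by (intro exI[of _ "cosh z - 1"]) (auto intro!: derivative_eq_intros)
  qed
  then show ?thesis by simp
qed

theorem theorem1p2:
  fixes f1 f2 s2 :: "real \<Rightarrow> real" and \<nu>1 \<nu>2 :: "real measure"
    and P1 P2 :: "(real \<Rightarrow> real) measure" and T :: real
  assumes "levy_measure \<nu>1" and "levy_measure \<nu>2"
    and "absolutely_continuous \<nu>2 \<nu>1"
    and "L1_levy \<nu>1 \<nu>2 < \<infinity>"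
    and "additive_law P1 f1 s2 \<nu>1" and "additive_law P2 f2 s2 \<nu>2"
    and "0 < T"
  shows "((\<forall>r\<ge>0. s2 r > 0) \<longrightarrow>
           (\<forall>\<xi>::ereal. \<xi> \<ge> 0 \<and> \<xi>\<^sup>2 = enn2ereal (xi_squared T f1 f2 s2 \<nu>1 \<nu>2) \<longrightarrow>
              L1_prob (law_upto T P1) (law_upto T P2)
                \<le> 2 * sinh (T * enn2real (L1_levy \<nu>1 \<nu>2)) + 2 * (1 - 2 * std_normal_cdf (- \<xi> / 2))))
       \<and> ((\<forall>r\<ge>0. s2 r = 0) \<and> (\<forall>r\<ge>0. f1 r - f2 r = gamma_diff \<nu>1 \<nu>2) \<longrightarrow>
              L1_prob (law_upto T P1) (law_upto T P2)
                \<le> 2 * sinh (T * enn2real (L1_levy \<nu>1 \<nu>2)))"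
proof (intro conjI impI allI)
  define L where "L = T * enn2real (L1_levy \<nu>1 \<nu>2)"
  have L: "0 \<le> L" "L \<le> sinh L" using \<open>0 < T\<close> by (auto simp: L_def intro!: le_sinh_real)
  note ctx = assms(3-6)
  note tvi = tv_bound_increments[OF ctx]
  {
    assume "(\<forall>r\<ge>0. s2 r = 0) \<and> (\<forall>r\<ge>0. f1 r - f2 r = gamma_diff \<nu>1 \<nu>2)"
    then have drift: "\<And>r. 0 \<le> r \<Longrightarrow> f1 r - f2 r = gamma_diff \<nu>1 \<nu>2" by auto
    have "L1_prob (law_upto T P1) (law_upto T P2) \<le> 2 * L"
    proof (rule L1_prob_law_upto_le[OF assms(5-7)])
      fix t :: "nat \<Rightarrow> real" and n assume t: "t 0 = 0" "\<And>i. t i < t (Suc i)" "0 < n" "t n = T"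
      have t0: "0 \<le> t i" for i
        using t(1,2) by (induction i) (auto intro: order_trans less_imp_le)
      have shift: "drift_shift f1 f2 \<nu>1 \<nu>2 (t i) (t (Suc i)) = 0" for i
      \<comment> \<open>The drift condition holds at nonnegative times, and all partition intervals
        lie there.\<close>
      proof -
        have "drift_shift f1 f2 \<nu>1 \<nu>2 (t i) (t (Suc i)) = (LINT r:{t i<..t (Suc i)}|lebesgue. 0)"
          unfolding drift_shift_def[OF ctx] set_lebesgue_integral_def
          using drift t0[of i] by (intro Bochner_Integration.integral_cong refl) (auto simp: indicator_def)
        then show ?thesis by simp
      qed
      have "(increment_law P2 (t i) (t (Suc i)) \<star> return borel 0) = increment_law P2 (t i) (t (Suc i))" for i
        by (rule real_distribution_eqI_char)
          (auto simp: char_convolution char_return real_distribution_increment_law[OF assms(6) t0 t0]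
            real_distribution_return intro!: real_distribution_convolution)
      then have "tv_bound (t n * enn2real (L1_levy \<nu>1 \<nu>2) + 0) (PiM {..<n} (\<lambda>i. increment_law P1 (t i) (t (Suc i))))
        (PiM {..<n} (\<lambda>i. increment_law P2 (t i) (t (Suc i))))"
        by (intro tvi t) (simp add: shift tv_bound_def)
      then show "tv_bound L (PiM {..<n} (\<lambda>i. increment_law P1 (t i) (t (Suc i))))
        (PiM {..<n} (\<lambda>i. increment_law P2 (t i) (t (Suc i))))"
        by (simp add: L_def t(4))
    qed
    then show "L1_prob (law_upto T P1) (law_upto T P2) \<le> 2 * sinh (T * enn2real (L1_levy \<nu>1 \<nu>2))"
      using L unfolding L_def by linarith
  }
  fix \<xi> :: ereal
  assume s2: "\<forall>r\<ge>0. 0 < s2 r" and \<xi>: "0 \<le> \<xi> \<and> \<xi>\<^sup>2 = enn2ereal (xi_squared T f1 f2 s2 \<nu>1 \<nu>2)"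
  show "L1_prob (law_upto T P1) (law_upto T P2)
    \<le> 2 * sinh (T * enn2real (L1_levy \<nu>1 \<nu>2)) + 2 * (1 - 2 * std_normal_cdf (- \<xi> / 2))"
  proof (cases \<xi>)
    case (real x)
    define c where "c = cdf std_normal_distribution (x / 2) - cdf std_normal_distribution (- x / 2)"
    interpret N: real_distribution std_normal_distribution by (rule real_dist_normal_dist)
    have x: "0 \<le> x" "xi_squared T f1 f2 s2 \<nu>1 \<nu>2 = ennreal (x\<^sup>2)"
      using \<xi> real by (cases "xi_squared T f1 f2 s2 \<nu>1 \<nu>2";
          auto simp: enn2ereal_ennreal power2_eq_square top_ereal_def)+
    have "L1_prob (law_upto T P1) (law_upto T P2) \<le> 2 * (L + c)"
    proof (rule L1_prob_law_upto_le[OF assms(5-7)])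
      fix t :: "nat \<Rightarrow> real" and n assume t: "t 0 = 0" "\<And>i. t i < t (Suc i)" "0 < n" "t n = T"
      define y where "y = sqrt (\<Sum>i<n. (drift_shift f1 f2 \<nu>1 \<nu>2 (t i) (t (Suc i)))\<^sup>2 / (LINT r:{t i<..t (Suc i)}|lebesgue. s2 r))"
      have "(\<Sum>i<n. (drift_shift f1 f2 \<nu>1 \<nu>2 (t i) (t (Suc i)))\<^sup>2 / (LINT r:{t i<..t (Suc i)}|lebesgue. s2 r)) \<le> x\<^sup>2"
        using s2 x t by (intro sum_drift_shift_le_xi_squared[OF ctx]) auto
      then have "y \<le> x"
        unfolding y_def using x(1) by (intro real_le_lsqrt) auto
      \<comment> \<open>The Gaussian bound increases with its argument, so replacing y by x removes
        the dependence on the partition.\<close>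
      then have "cdf std_normal_distribution (y / 2) - cdf std_normal_distribution (- y / 2) \<le> c"
        unfolding c_def by (intro diff_mono N.cdf_nondecreasing) auto
      with tv_bound_drift_shift[OF ctx t(1-3)] s2
      have "tv_bound c
        (PiM {..<n} (\<lambda>i. increment_law P2 (t i) (t (Suc i)) \<star> return borel (drift_shift f1 f2 \<nu>1 \<nu>2 (t i) (t (Suc i)))))
        (PiM {..<n} (\<lambda>i. increment_law P2 (t i) (t (Suc i))))"
        by (auto simp: y_def intro: tv_bound_mono)
      from tvi[OF t(1,2) this]
      show "tv_bound (L + c) (PiM {..<n} (\<lambda>i. increment_law P1 (t i) (t (Suc i))))
        (PiM {..<n} (\<lambda>i. increment_law P2 (t i) (t (Suc i))))"
        by (simp add: L_def t(4))
    qed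
    moreover have "- \<xi> / 2 = ereal (- x / 2)" using real by simp
    then have "std_normal_cdf (- \<xi> / 2) = cdf std_normal_distribution (- x / 2)"
      by (simp add: std_normal_cdf_def)
    moreover have "c = 1 - 2 * cdf std_normal_distribution (- x / 2)"
      using cdf_std_normal_symmetric[of "x / 2"] by (simp add: c_def)
    ultimately show ?thesis using L(2) unfolding L_def by simp
  next
    \<comment> \<open>Here \<open>std_normal_cdf\<close> is evaluated at minus infinity and gives 0,
      so the claimed bound is at least 2, which no \<open>L1_prob\<close> of probability laws
      exceeds.\<close>
    case PInf
    have "L1_prob (law_upto T P1) (law_upto T P2) \<le> 2 * 1"
    proof (rule L1_prob_law_upto_le[OF assms(5-7)])
      fix t :: "nat \<Rightarrow> real" and n assume t: "t 0 = 0" "\<And>i. t i < t (Suc i)"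
      have t0: "0 \<le> t i" for i
        using t by (induction i) (auto intro: order_trans less_imp_le)
      have ps: "prob_space (PiM {..<n} (\<lambda>i. increment_law P (t i) (t (Suc i))))" if "additive_law P f s2 \<nu>" for P f \<nu>
        using real_distribution_increment_law[OF that t0 t0]
        by (intro prob_space_PiM) (simp add: real_distribution_def)
      have "sets (PiM {..<n} (\<lambda>i. increment_law P1 (t i) (t (Suc i)))) = sets (PiM {..<n} (\<lambda>i. increment_law P2 (t i) (t (Suc i))))"
        by (intro sets_PiM_cong) (auto simp: increment_law_def)
      moreover have "\<bar>a - b\<bar> \<le> 1" if "0 \<le> a" "a \<le> 1" "0 \<le> b" "b \<le> 1" for a b :: real
        using that by auto
      ultimately show "tv_bound 1 (PiM {..<n} (\<lambda>i. increment_law P1 (t i) (t (Suc i))))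
        (PiM {..<n} (\<lambda>i. increment_law P2 (t i) (t (Suc i))))"
        using prob_space.prob_le_1[OF ps[OF assms(5)]] prob_space.prob_le_1[OF ps[OF assms(6)]]
        by (simp add: tv_bound_def)
    qed
    moreover have "std_normal_cdf (- \<xi> / 2) = 0" using PInf by (simp add: std_normal_cdf_def)
    ultimately show ?thesis using L unfolding L_def by simp
  qed (use \<xi> in auto)
qed

end
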